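(* Let $(X,d,\mathfrak{m})$ be a metric measure space. Let $(d_i)_{i\in\mathbb{N}}$ be a sequence of distances on $X$ such that $d_i(x,y)\nearrow d(x,y)$ as $i\to\infty$ for every $x,y\in X$ (that is, $d_i(x,y)\le d_{i+1}(x,y)$ for all $i$ and $\lim_{i\to\infty}d_i(x,y)=d(x,y)$), and such that for every $i\in\mathbb{N}$ the distances $d_i$ and $d$ induce the same topology on $X$. Fix an exponent $p\in(1,\infty)$ and a boundedly-supported function $f\in\mathrm{LIP}_d(X)$. Then for every $\varepsilon>0$ there exist $i\in\mathbb{N}$ and a boundedly-supported function $g\in\mathrm{LIP}_{d_i}(X)$ such that $$\int|g-f|^p\,d\mathfrak{m}\le\varepsilon\qquad\text{and}\qquad\int\mathrm{lip}_a^{d_i}(g)^p\,d\mathfrak{m}\le\int\mathrm{lip}_a^{d}(f)^p\,d\mathfrak{m}+\varepsilon.$$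
   Context: A metric measure space $(X,d,\mathfrak{m})$ is a complete separable metric space $(X,d)$ endowed with a Borel measure $\mathfrak{m}\ge 0$ that is boundedly finite, i.e. finite on $d$-bounded Borel sets. For a distance $d$ on $X$, let $\mathrm{LIP}_d(X)$ be the space of $d$-Lipschitz functions $f:X\to\mathbb{R}$. For $f\in\mathrm{LIP}_d(X)$ and $E\subseteq X$ set $$\mathrm{Lip}_d(f;E):=\sup\Big\{\tfrac{|f(x)-f(y)|}{d(x,y)}: x,y\in E,\ x\ne y\Big\},$$ with value $0$ if $E$ is empty or a singleton. The asymptotic slope is $\mathrm{lip}_a^d(f)(x):=\inf_{r>0}\mathrm{Lip}_d(f;B_r^d(x))$, $x\in X$, where $B_r^d(x)=\{y\in X: d(x,y)<r\}$. The objects $\mathrm{LIP}_{d_i}(X)$ and $\mathrm{lip}_a^{d_i}$ are defined in the same way with $d_i$ in place of $d$. A function in $\mathrm{LIP}_d(X)$ is boundedly-supported if its support, the closure of the set where it is nonzero, is $d$-bounded; likewise, a function in $\mathrm{LIP}_{d_i}(X)$ is boundedly-supported if its support is $d_i$-bounded. *)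

theory Defs
  imports "HOL-Analysis.Analysis"
begin

text \<open>
  A metric space is a carrier \<open>M\<close> with a distance function \<open>d\<close>, so that several distances can live
  on one set. Real-valued functions on the space are total functions on the ambient type; their
  values outside \<open>M\<close> are never used.
\<close>

context Metric_space
begin

definition separable :: bool
  where "separable \<longleftrightarrow> (\<exists>S. countable S \<and> S \<subseteq> M \<and> mtopology closure_of S = M)"

definition LIP :: "('a \<Rightarrow> real) set"
  where "LIP = {f. Lipschitz_continuous_map (metric (M, d)) euclidean_metric f}"

text \<open>
  The supremum is a real one. For \<open>f \<in> LIP\<close> and \<open>E \<subseteq> M\<close> the quotients are bounded, so it is the
  genuine supremum; the case distinction implements the convention for empty and singleton \<open>E\<close>.
\<close>

definition Lip :: "('a \<Rightarrow> real) \<Rightarrow> 'a set \<Rightarrow> real"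
  where "Lip f E =
    (if \<exists>x\<in>E. \<exists>y\<in>E. x \<noteq> y
     then Sup {\<bar>f x - f y\<bar> / d x y | x y. x \<in> E \<and> y \<in> E \<and> x \<noteq> y}
     else 0)"

definition lip_a :: "('a \<Rightarrow> real) \<Rightarrow> 'a \<Rightarrow> real"
  where "lip_a f x = (INF r\<in>{0<..}. Lip f (mball x r))"

definition boundedly_supported :: "('a \<Rightarrow> real) \<Rightarrow> bool"
  where "boundedly_supported f \<longleftrightarrow> mbounded (mtopology closure_of {x \<in> M. f x \<noteq> 0})"

end

text \<open>
  The condition on \<open>sets \<mm>\<close> says that \<open>\<mm>\<close> is a measure on the Borel sets of \<open>(M, d)\<close>; it also forces
  \<open>space \<mm> = M\<close>.
\<close>

locale metric_measure_space = Metric_space M d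
  for M :: "'a set" and d :: "'a \<Rightarrow> 'a \<Rightarrow> real" +
  fixes \<mm> :: "'a measure"
  assumes complete: "mcomplete"
    and separable: "separable"
    and borel: "sets \<mm> = sigma_sets M {U. openin mtopology U}"
    and boundedly_finite: "\<And>B. B \<in> sets \<mm> \<Longrightarrow> mbounded B \<Longrightarrow> emeasure \<mm> B < \<infinity>"
begin

lemma space_eq: "space \<mm> = M"
proof -
  have "sets \<mm> = sets (sigma M {U. openin mtopology U})"
    using borel openin_subset[of mtopology] by (subst sets_measure_of) auto
  then have "space \<mm> = space (sigma M {U. openin mtopology U})"
    by (rule sets_eq_imp_space_eq)
  then show ?thesis
    by (simp add: space_measure_of_conv)
qed

end

end

theory Submission
  imports Defs
begin

text \<open>
  Let \<open>S\<close> be the support of \<open>f\<close>. A function whose \<open>d\<^sub>i\<close>-slope is controlled by a prescribed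
  continuous weight \<open>\<rho>\<close> is obtained by minimising over discrete chains \<open>p\<^sub>0, \<dots>, p\<^sub>n = x\<close> with short
  \<open>d\<^sub>i\<close>-steps the cost \<open>f p\<^sub>0 + (\<Sum>k<n. \<rho> p\<^sub>k * d\<^sub>i p\<^sub>k p\<^bsub>k+1\<^esub>)\<close>. The infimum \<open>u\<close> satisfies \<open>u \<le> f\<close>, and one-step
  chains show that its slope is at most \<open>\<rho>\<close>. The median \<open>g\<close> of \<open>u\<close>, \<open>0\<close> and the analogous supremum
  vanishes where \<open>f\<close> does, so that \<open>\<integral> lip\<^sub>a(g)\<^sup>p \<le> \<integral>\<^sub>S \<rho>\<^sup>p\<close>, and it remains to choose weights \<open>\<rho>\<^sub>i\<close> for which
  the energy on the right is close to that of \<open>lip\<^sub>a(f)\<close> while \<open>u\<^sub>i \<longlonglongrightarrow> f\<close> pointwise; dominated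
  convergence on \<open>S\<close>, which has finite measure, then gives \<open>g\<^sub>i \<longlonglongrightarrow> f\<close> in \<open>L\<^sup>p\<close>.

  The weight \<open>\<rho>\<^sub>i\<close> is the sum of two terms. The first is a continuous function slightly larger
  than the upper semicontinuous function \<open>lip\<^sub>a(f)\<close>; it makes \<open>\<rho>\<^sub>i\<close> a local Lipschitz constant of
  \<open>f\<close>, so that along limits of chains \<open>f\<close> cannot increase faster than the cost. The second forces
  compactness. The distances \<open>d\<^sub>i\<close> need not converge to \<open>d\<close> uniformly on bounded sets, and chains could
  use shortcuts that disappear only in the limit. As \<open>S\<close> has finite measure and \<open>d\<close> is separable,
  \<open>S\<close> is covered up to tiny sets by finitely many small balls, and making the weight large off these balls
  costs little energy (\<open>coercive_weights\<close>). Chains of bounded cost then pass through points that have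
  limits in \<open>d\<close>, and along a \<open>d\<close>-convergent sequence \<open>q\<^sub>i \<longlonglongrightarrow> q\<close> monotonicity does give
  \<open>d\<^sub>i(x, q\<^sub>i) \<longlonglongrightarrow> d(x, q)\<close>.

  The convergence \<open>u\<^sub>i \<longlonglongrightarrow> f\<close> is proved by contradiction. Suppose that the lower
  \<open>\<Gamma>\<close>-limit \<open>v\<close> of \<open>u\<^sub>i\<close> is smaller than \<open>f\<close> at \<open>x\<close>. Following nearly optimal chains back from \<open>x\<close>
  through a small annulus leads to a point \<open>q \<noteq> x\<close> with \<open>v q \<le> v x - e * d x q\<close> at which the gap
  \<open>f - v\<close> is at least as large (\<open>limit_epigraph_descent\<close>). By completeness such moves cannot be
  repeated forever (\<open>no_perpetual_descent\<close>, in the spirit of Caristi's fixed point theorem), a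
  contradiction.
\<close>

section \<open>Lipschitz functions, slopes and continuity on a metric space\<close>

context Metric_space
begin

lemma LIP_iff: "f \<in> LIP \<longleftrightarrow> (\<exists>L\<ge>0. \<forall>x\<in>M. \<forall>y\<in>M. \<bar>f x - f y\<bar> \<le> L * d x y)"
proof -
  have "f \<in> LIP \<longleftrightarrow> (\<exists>L>0. \<forall>x\<in>M. \<forall>y\<in>M. \<bar>f x - f y\<bar> \<le> L * d x y)"
    by (simp add: LIP_def Lipschitz_continuous_map_pos Self_def[symmetric] dist_real_def)
  moreover have "(\<exists>L>0. \<forall>x\<in>M. \<forall>y\<in>M. \<bar>f x - f y\<bar> \<le> L * d x y)"
    if "L \<ge> 0" "\<forall>x\<in>M. \<forall>y\<in>M. \<bar>f x - f y\<bar> \<le> L * d x y" for L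
  proof (intro exI conjI ballI)
    show "L + 1 > 0" using that by simp
    fix x y assume "x \<in> M" "y \<in> M"
    then have "\<bar>f x - f y\<bar> \<le> L * d x y" using that by blast
    also have "\<dots> \<le> (L + 1) * d x y" by (simp add: mult_right_mono)
    finally show "\<bar>f x - f y\<bar> \<le> (L + 1) * d x y" .
  qed
  ultimately show ?thesis
    using less_imp_le by blast
qed

lemma Lip_le:
  assumes "E \<subseteq> M" "0 \<le> C" "\<And>x y. x \<in> E \<Longrightarrow> y \<in> E \<Longrightarrow> \<bar>f x - f y\<bar> \<le> C * d x y"
  shows "Lip f E \<le> C"
proof (cases "\<exists>x\<in>E. \<exists>y\<in>E. x \<noteq> y")
  case True
  have "c \<le> C" if c: "c \<in> {\<bar>f x - f y\<bar> / d x y | x y. x \<in> E \<and> y \<in> E \<and> x \<noteq> y}" for c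
  proof -
    obtain x y where "c = \<bar>f x - f y\<bar> / d x y" "x \<in> E" "y \<in> E" "x \<noteq> y"
      using c by blast
    then show ?thesis
      using assms mdist_pos_less[of x y] by (simp add: divide_le_eq subset_iff)
  qed
  with True show ?thesis
    by (auto simp: Lip_def intro!: cSup_least)
qed (simp add: Lip_def assms)

lemma Lip_quotients_bdd_above:
  assumes "f \<in> LIP" "E \<subseteq> M"
  shows "bdd_above {\<bar>f x - f y\<bar> / d x y | x y. x \<in> E \<and> y \<in> E \<and> x \<noteq> y}"
proof -
  obtain L where L: "L \<ge> 0" "\<And>x y. x \<in> M \<Longrightarrow> y \<in> M \<Longrightarrow> \<bar>f x - f y\<bar> \<le> L * d x y"
    using assms(1) LIP_iff by blast
  have "c \<le> L" if c: "c \<in> {\<bar>f x - f y\<bar> / d x y | x y. x \<in> E \<and> y \<in> E \<and> x \<noteq> y}" for c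
  proof -
    obtain x y where "c = \<bar>f x - f y\<bar> / d x y" "x \<in> M" "y \<in> M" "x \<noteq> y"
      using c assms(2) by blast
    then show ?thesis
      using L(2)[of x y] mdist_pos_less[of x y] by (simp add: divide_le_eq)
  qed
  then show ?thesis by (rule bdd_aboveI)
qed

lemma le_Lip_mult_dist:
  assumes "f \<in> LIP" "E \<subseteq> M" "x \<in> E" "y \<in> E"
  shows "\<bar>f x - f y\<bar> \<le> Lip f E * d x y"
proof (cases "x = y")
  case True
  then show ?thesis using assms by (auto simp: subset_iff)
next
  case False
  then have "\<bar>f x - f y\<bar> / d x y \<le> Lip f E"
    using assms Lip_quotients_bdd_above[OF assms(1,2)]
    by (auto simp: Lip_def intro!: cSup_upper)
  moreover have "d x y > 0"
    using False assms mdist_pos_less by blast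
  ultimately show ?thesis
    by (simp add: divide_le_eq)
qed

lemma Lip_nonneg:
  assumes "f \<in> LIP" "E \<subseteq> M"
  shows "0 \<le> Lip f E"
proof (cases "\<exists>x\<in>E. \<exists>y\<in>E. x \<noteq> y")
  case True
  then obtain x y where xy: "x \<in> E" "y \<in> E" "x \<noteq> y" by blast
  then have "0 \<le> Lip f E * d x y"
    using le_Lip_mult_dist[OF assms, of x y] by linarith
  moreover have "d x y > 0"
    using xy assms(2) mdist_pos_less by blast
  ultimately show ?thesis
    by (simp add: zero_le_mult_iff)
qed (simp add: Lip_def)

lemma Lip_mono:
  assumes "f \<in> LIP" "E \<subseteq> E'" "E' \<subseteq> M"
  shows "Lip f E \<le> Lip f E'"
  using assms by (intro Lip_le Lip_nonneg le_Lip_mult_dist[of f E']) blast+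

lemma lip_a_le_Lip_mball:
  assumes "f \<in> LIP" "0 < r"
  shows "lip_a f x \<le> Lip f (mball x r)"
proof -
  have "bdd_below ((\<lambda>r. Lip f (mball x r)) ` {0<..})"
    by (rule bdd_belowI[of _ 0]) (auto intro!: Lip_nonneg assms mball_subset_mspace)
  then show ?thesis
    unfolding lip_a_def by (rule cINF_lower) (use assms in auto)
qed

lemma lip_a_nonneg: "f \<in> LIP \<Longrightarrow> 0 \<le> lip_a f x"
  unfolding lip_a_def
  by (rule cINF_greatest) (auto intro!: Lip_nonneg mball_subset_mspace)

lemma lip_a_lessD:
  assumes "lip_a f x < c"
  obtains r where "r > 0" "Lip f (mball x r) < c"
proof -
  have "\<exists>r>0. Lip f (mball x r) < c"
  proof (rule ccontr)
    assume "\<not> (\<exists>r>0. Lip f (mball x r) < c)"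
    then have "c \<le> Lip f (mball x r)" if "r > 0" for r
      using that by (meson not_less)
    then have "c \<le> lip_a f x"
      unfolding lip_a_def by (intro cINF_greatest) auto
    with assms show False by simp
  qed
  with that show thesis by blast
qed

text \<open>The asymptotic slope is upper semicontinuous, since small balls around points near
  \<open>x\<close> lie in a fixed ball around \<open>x\<close>.\<close>

lemma lip_a_less_near:
  assumes "f \<in> LIP" "lip_a f x < c"
  obtains r where "r > 0" "\<And>y. y \<in> mball x r \<Longrightarrow> lip_a f y < c"
proof -
  obtain r where r: "r > 0" "Lip f (mball x r) < c"
    using lip_a_lessD[OF assms(2)] by blast
  have "lip_a f y < c" if y: "y \<in> mball x r" for y
  proof -
    obtain s where s: "s > 0" "mball y s \<subseteq> mball x r"
      using y openin_mball[of x r] unfolding openin_mtopology by blast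
    have "lip_a f y \<le> Lip f (mball y s)"
      using assms(1) s(1) by (rule lip_a_le_Lip_mball)
    also have "\<dots> \<le> Lip f (mball x r)"
      using assms(1) s(2) mball_subset_mspace by (rule Lip_mono)
    finally show ?thesis using r by simp
  qed
  with r(1) that show thesis by blast
qed

lemma continuous_map_real_iff:
  "continuous_map mtopology euclideanreal h \<longleftrightarrow>
    (\<forall>x\<in>M. \<forall>e>0. \<exists>r>0. \<forall>y\<in>mball x r. \<bar>h y - h x\<bar> < e)"
proof -
  have "continuous_map mtopology Met_TC.mtopology h \<longleftrightarrow>
    (\<forall>x\<in>M. \<forall>e>0. \<exists>r>0. \<forall>y. y \<in> M \<and> d x y < r \<longrightarrow> dist (h x) (h y) < e)"
    by (subst metric_continuous_map) (simp_all add: Met_TC.Metric_space_axioms)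
  moreover have "Met_TC.mtopology = (euclideanreal)"
    using mtopology_of_euclidean by (simp add: mtopology_of_def)
  ultimately show ?thesis
    by (simp add: dist_real_def abs_minus_commute Ball_def)
qed

lemma Lipschitz_imp_continuous_map:
  assumes "\<And>x y. x \<in> M \<Longrightarrow> y \<in> M \<Longrightarrow> \<bar>h x - h y\<bar> \<le> L * d x y"
  shows "continuous_map mtopology euclideanreal h"
  unfolding continuous_map_real_iff
proof (intro ballI allI impI)
  fix x and e :: real assume "x \<in> M" "0 < e"
  have "\<bar>h y - h x\<bar> < e" if y: "y \<in> mball x (e / (\<bar>L\<bar> + 1))" for y
  proof -
    have "\<bar>h y - h x\<bar> \<le> L * d x y"
      using assms[of x y] y by (simp add: abs_minus_commute)
    also have "\<dots> \<le> (\<bar>L\<bar> + 1) * d x y"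
      by (rule mult_right_mono) auto
    also have "\<dots> < e"
      using y by (simp add: pos_less_divide_eq mult.commute add_nonneg_pos)
    finally show ?thesis .
  qed
  then show "\<exists>r>0. \<forall>y\<in>mball x r. \<bar>h y - h x\<bar> < e"
    using \<open>0 < e\<close> by (intro exI[of _ "e / (\<bar>L\<bar> + 1)"]) (auto intro!: divide_pos_pos)
qed

lemma LIP_imp_continuous_map: "h \<in> LIP \<Longrightarrow> continuous_map mtopology euclideanreal h"
  unfolding LIP_iff using Lipschitz_imp_continuous_map by blast

text \<open>Distance functions (\<open>a = 0\<close>) and the Lipschitz regularisations of bounded functions
  are both of the form below.\<close>

lemma inf_convolution_Lipschitz:
  assumes "A \<noteq> {}" "A \<subseteq> M" "c \<ge> 0" "\<And>y. y \<in> A \<Longrightarrow> b \<le> a y" "x \<in> M" "x' \<in> M"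
  shows "\<bar>(INF y\<in>A. a y + c * d x y) - (INF y\<in>A. a y + c * d x' y)\<bar> \<le> c * d x x'"
proof -
  have bdd: "bdd_below ((\<lambda>y. a y + c * d x y) ` A)" for x
    by (rule bdd_belowI[of _ b]) (use assms in \<open>auto intro!: add_increasing2\<close>)
  have *: "(INF y\<in>A. a y + c * d x y) - c * d x x' \<le> (INF y\<in>A. a y + c * d x' y)"
    if "x \<in> M" "x' \<in> M" for x x'
  proof (rule cINF_greatest[OF \<open>A \<noteq> {}\<close>])
    fix y assume y: "y \<in> A"
    have "(INF y\<in>A. a y + c * d x y) \<le> a y + c * d x y"
      by (rule cINF_lower[OF bdd y])
    also have "c * d x y \<le> c * (d x x' + d x' y)"
      using triangle[of x x' y] that y assms by (intro mult_left_mono) auto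
    finally show "(INF y\<in>A. a y + c * d x y) - c * d x x' \<le> a y + c * d x' y"
      by (simp add: algebra_simps)
  qed
  show ?thesis
    using *[OF assms(5,6)] *[OF assms(6,5)] commute[of x x'] by (simp add: abs_le_iff)
qed

lemma mtotally_boundedI:
  assumes "S \<subseteq> M"
    and cover: "\<And>t. t > 0 \<Longrightarrow> \<exists>K. finite K \<and> K \<subseteq> M \<and> S \<subseteq> (\<Union>y\<in>K. mball y t)"
  shows "mtotally_bounded S"
  unfolding mtotally_bounded_def
proof (intro allI impI)
  fix t :: real assume "t > 0"
  then obtain K where K: "finite K" "K \<subseteq> M" "S \<subseteq> (\<Union>y\<in>K. mball y (t / 2))"
    using cover[of "t / 2"] by auto
  define K' where "K' = {y \<in> K. S \<inter> mball y (t / 2) \<noteq> {}}"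
  have "\<forall>y\<in>K'. \<exists>z. z \<in> S \<inter> mball y (t / 2)" unfolding K'_def by blast
  then obtain z where z: "\<And>y. y \<in> K' \<Longrightarrow> z y \<in> S \<inter> mball y (t / 2)"
    by metis
  have "x \<in> (\<Union>y\<in>z ` K'. mball y t)" if x: "x \<in> S" for x
  proof -
    obtain y where y: "y \<in> K" "x \<in> mball y (t / 2)" using x K by blast
    then have "y \<in> K'" using x unfolding K'_def by blast
    moreover have "x \<in> mball (z y) t"
      using z[OF \<open>y \<in> K'\<close>] y triangle''[of "z y" y x] by auto
    ultimately show ?thesis by blast
  qed
  moreover have "finite K'" using K by (simp add: K'_def)
  ultimately show "\<exists>K. finite K \<and> K \<subseteq> S \<and> S \<subseteq> (\<Union>x\<in>K. mball x t)"
    using z by (intro exI[of _ "z ` K'"]) auto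
qed

end

section \<open>A Caristi-type principle\<close>

text \<open>Moving from \<open>(x, a)\<close> to a point whose second coordinate is lower by at least \<open>e\<close> times
  the distance travelled cannot go on forever in a complete space: choosing each time nearly the
  best available decrease gives a Cauchy sequence, and its limit admits no further move.\<close>

lemma (in Metric_space) no_perpetual_descent:
  fixes P :: "'a \<Rightarrow> real \<Rightarrow> bool"
  assumes complete: mcomplete
    and "e > 0"
    and closed: "\<And>x a. x \<in> M \<Longrightarrow>
      (\<And>t. t > 0 \<Longrightarrow> \<exists>y\<in>M. \<exists>b. P y b \<and> d y x < t \<and> \<bar>b - a\<bar> < t) \<Longrightarrow> P x a"
    and bounded: "\<And>x a. x \<in> M \<Longrightarrow> P x a \<Longrightarrow> B \<le> a"
    and descent: "\<And>x a. x \<in> M \<Longrightarrow> P x a \<Longrightarrow> \<exists>y\<in>M. \<exists>b. P y b \<and> b < a \<and> b \<le> a - e * d x y"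
    and "x0 \<in> M"
  shows "\<not> P x0 a0"
proof
  assume P0: "P x0 a0"
  define R where "R s = {b. \<exists>y\<in>M. P y b \<and> b \<le> snd s - e * d (fst s) y}" for s
  have R_bdd: "bdd_below (R s)" for s
    by (rule bdd_belowI[of _ B]) (auto simp: R_def bounded)
  have next_ex: "\<exists>s'. (fst s' \<in> M \<and> P (fst s') (snd s')) \<and>
      snd s' \<le> snd s - e * d (fst s) (fst s') \<and> snd s' \<le> (snd s + Inf (R s)) / 2"
    if s: "fst s \<in> M \<and> P (fst s) (snd s)" for s
  proof -
    obtain y b where yb: "y \<in> M" "P y b" "b < snd s" "b \<le> snd s - e * d (fst s) y"
      using descent s by blast
    then have "b \<in> R s" by (auto simp: R_def)
    then have "Inf (R s) \<le> b" using R_bdd by (rule cInf_lower)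
    then have "Inf (R s) < (snd s + Inf (R s)) / 2" using yb by simp
    then obtain b' where "b' \<in> R s" "b' < (snd s + Inf (R s)) / 2"
      using cInf_lessD \<open>b \<in> R s\<close> by blast
    then show ?thesis unfolding R_def by force
  qed
  obtain s where s0: "s 0 = (x0, a0)" and s: "\<And>n. fst (s n) \<in> M \<and> P (fst (s n)) (snd (s n))"
    and step: "\<And>n. snd (s (Suc n)) \<le> snd (s n) - e * d (fst (s n)) (fst (s (Suc n))) \<and>
      snd (s (Suc n)) \<le> (snd (s n) + Inf (R (s n))) / 2"
  proof -
    have "\<exists>s. \<forall>n. (fst (s n) \<in> M \<and> P (fst (s n)) (snd (s n)) \<and> (n = 0 \<longrightarrow> s n = (x0,a0))) \<and>
       (snd (s (Suc n)) \<le> snd (s n) - e * d (fst (s n)) (fst (s (Suc n))) \<and>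
      snd (s (Suc n)) \<le> (snd (s n) + Inf (R (s n))) / 2)"
      by (rule dependent_nat_choice) (use P0 \<open>x0 \<in> M\<close> next_ex in \<open>force+\<close>)
    then show thesis using that by blast
  qed
  have drop: "snd (s n) \<le> snd (s m) - e * d (fst (s m)) (fst (s n))" if "m \<le> n" for m n
    using that
  proof (induction n rule: dec_induct)
    case base
    show ?case using s[of m] by simp
  next
    case (step n)
    have "d (fst (s m)) (fst (s (Suc n))) \<le> d (fst (s m)) (fst (s n)) + d (fst (s n)) (fst (s (Suc n)))"
      using s by (intro triangle) auto
    then have "e * d (fst (s m)) (fst (s (Suc n)))
        \<le> e * d (fst (s m)) (fst (s n)) + e * d (fst (s n)) (fst (s (Suc n)))"
      using \<open>e > 0\<close> by (simp add: distrib_left[symmetric])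
    then show ?case
      using step.IH \<open>\<And>n. snd (s (Suc n)) \<le> _ \<and> _\<close>[of n] by linarith
  qed
  have "decseq (\<lambda>n. snd (s n))"
    unfolding decseq_def using drop \<open>e > 0\<close> s
    by (smt (verit, ccfv_SIG) mult_nonneg_nonneg nonneg)
  moreover have "\<And>n. B \<le> snd (s n)" using s bounded by blast
  ultimately obtain b where b: "(\<lambda>n. snd (s n)) \<longlonglongrightarrow> b" "\<And>n. b \<le> snd (s n)"
    using decseq_convergent[of "\<lambda>n. snd (s n)" B] by metis
  have dist_le: "d (fst (s m)) (fst (s n)) \<le> (snd (s m) - b) / e" if "m \<le> n" for m n
    using drop[OF that] b(2)[of n] \<open>e > 0\<close> by (simp add: pos_le_divide_eq algebra_simps)
  have "MCauchy (\<lambda>n. fst (s n))"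
    unfolding MCauchy_def
  proof (intro conjI allI impI)
    show "range (\<lambda>n. fst (s n)) \<subseteq> M" using s by auto
    fix t :: real assume "t > 0"
    then have "eventually (\<lambda>n. snd (s n) < b + e * t / 2) sequentially"
      using b(1) \<open>e > 0\<close> by (intro order_tendstoD(2)) auto
    then obtain N where N: "snd (s N) < b + e * t / 2"
      unfolding eventually_sequentially by blast
    have "d (fst (s N)) (fst (s n)) < t / 2" if "N \<le> n" for n
    proof -
      have "(snd (s N) - b) / e < t / 2" using N \<open>e > 0\<close> by (simp add: field_simps)
      with dist_le[OF that] show ?thesis by linarith
    qed
    then show "\<exists>N. \<forall>n n'. N \<le> n \<longrightarrow> N \<le> n' \<longrightarrow> d (fst (s n)) (fst (s n')) < t"
      using triangle''[of "fst (s _)" "fst (s N)" "fst (s _)"] s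
      by (intro exI[of _ N]) (smt (verit, ccfv_threshold) field_sum_of_halves)
  qed
  then obtain x where x: "limitin mtopology (\<lambda>n. fst (s n)) x sequentially"
    using complete unfolding mcomplete_def by blast
  then have xM: "x \<in> M" and dx: "(\<lambda>n. d (fst (s n)) x) \<longlonglongrightarrow> 0"
    unfolding limitin_metric_dist_null by auto
  have "P x b"
  proof (rule closed[OF xM])
    fix t :: real assume "t > 0"
    then have "eventually (\<lambda>n. d (fst (s n)) x < t \<and> snd (s n) < b + t) sequentially"
      using b(1) dx by (intro eventually_conj order_tendstoD(2)) auto
    then obtain n where "d (fst (s n)) x < t" "snd (s n) < b + t"
      unfolding eventually_sequentially by blast
    then show "\<exists>y\<in>M. \<exists>b'. P y b' \<and> d y x < t \<and> \<bar>b' - b\<bar> < t"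
      using s[of n] b(2)[of n] by (intro bexI[of _ "fst (s n)"] exI[of _ "snd (s n)"]) auto
  qed
  then obtain y c where y: "y \<in> M" "P y c" "c < b" "c \<le> b - e * d x y"
    using descent xM by blast
  have "b \<le> snd (s n) - e * d (fst (s n)) x" for n
  proof -
    have "(\<lambda>k. snd (s n) - e * (d (fst (s n)) x - d (fst (s k)) x)) \<longlonglongrightarrow>
        snd (s n) - e * (d (fst (s n)) x - 0)"
      by (intro tendsto_intros dx)
    moreover have "eventually (\<lambda>k. snd (s k) \<le> snd (s n) - e * (d (fst (s n)) x - d (fst (s k)) x)) sequentially"
      unfolding eventually_sequentially
    proof (intro exI allI impI)
      fix k assume "n \<le> k"
      have "d (fst (s n)) x \<le> d (fst (s n)) (fst (s k)) + d (fst (s k)) x"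
        using s xM by (intro triangle) auto
      then have "e * (d (fst (s n)) x - d (fst (s k)) x) \<le> e * d (fst (s n)) (fst (s k))"
        using \<open>e > 0\<close> by simp
      then show "snd (s k) \<le> snd (s n) - e * (d (fst (s n)) x - d (fst (s k)) x)"
        using drop[OF \<open>n \<le> k\<close>] by linarith
    qed
    ultimately have "b \<le> snd (s n) - e * (d (fst (s n)) x - 0)"
      using b(1) by (intro tendsto_le[OF sequentially_bot])
    then show ?thesis by simp
  qed
  moreover have "e * d (fst (s n)) y \<le> e * d (fst (s n)) x + e * d x y" for n
    using triangle[of "fst (s n)" x y] s xM y \<open>e > 0\<close> by (simp add: distrib_left[symmetric])
  ultimately have "c \<in> R (s n)" for n
    unfolding R_def using y by (smt (verit) mem_Collect_eq)
  then have "snd (s (Suc n)) \<le> (snd (s n) + c) / 2" for n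
    using step[of n] cInf_lower[OF _ R_bdd, of c "s n"] by fastforce
  moreover have "(\<lambda>n. (snd (s n) + c) / 2) \<longlonglongrightarrow> (b + c) / 2"
    by (intro tendsto_intros b) simp
  moreover have "(\<lambda>n. snd (s (Suc n))) \<longlonglongrightarrow> b"
    using b(1) by (rule LIMSEQ_Suc)
  ultimately have "b \<le> (b + c) / 2"
    by (intro tendsto_le[OF sequentially_bot, of _ _ "\<lambda>n. snd (s (Suc n))"]) auto
  with \<open>c < b\<close> show False by simp
qed

section \<open>Infima over discrete chains\<close>

text \<open>\<open>chain_cost \<delta> \<rho> f x c\<close> says that \<open>c = f p\<^sub>0 + (\<Sum>k<n. \<rho> p\<^sub>k * d p\<^sub>k p\<^bsub>k+1\<^esub>)\<close> for some
  chain \<open>p\<^sub>0, \<dots>, p\<^sub>n = x\<close> whose steps are at most \<open>\<delta>\<close> long. This is a discrete version of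
  \<open>f (\<gamma> 0) + \<integral>\<^sub>\<gamma> \<rho>\<close> for a curve \<open>\<gamma>\<close> ending at \<open>x\<close>.\<close>

context Metric_space
begin

inductive chain_cost :: "real \<Rightarrow> ('a \<Rightarrow> real) \<Rightarrow> ('a \<Rightarrow> real) \<Rightarrow> 'a \<Rightarrow> real \<Rightarrow> bool"
  for \<delta> \<rho> f where
  start: "x \<in> M \<Longrightarrow> chain_cost \<delta> \<rho> f x (f x)"
| extend: "chain_cost \<delta> \<rho> f x c \<Longrightarrow> y \<in> M \<Longrightarrow> d x y \<le> \<delta> \<Longrightarrow> chain_cost \<delta> \<rho> f y (c + \<rho> x * d x y)"

definition chain_inf :: "real \<Rightarrow> ('a \<Rightarrow> real) \<Rightarrow> ('a \<Rightarrow> real) \<Rightarrow> 'a \<Rightarrow> real"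
  where "chain_inf \<delta> \<rho> f x = Inf {c. chain_cost \<delta> \<rho> f x c}"

lemma chain_cost_in_space: "chain_cost \<delta> \<rho> f x c \<Longrightarrow> x \<in> M"
  by (induction rule: chain_cost.induct) auto

lemma chain_cost_ge:
  assumes "chain_cost \<delta> \<rho> f x c" "\<And>x. x \<in> M \<Longrightarrow> B \<le> f x" "\<And>x. x \<in> M \<Longrightarrow> 0 \<le> \<rho> x"
  shows "B \<le> c"
  using assms(1)
proof (induction rule: chain_cost.induct)
  case (extend x c y)
  have "0 \<le> \<rho> x * d x y"
    using assms(3) chain_cost_in_space[OF extend.hyps(1)] by simp
  then show ?case using extend.IH by simp
qed (use assms in auto)

context
  fixes \<delta> B :: real and \<rho> f :: "'a \<Rightarrow> real"
  assumes weight_nonneg: "\<And>x. x \<in> M \<Longrightarrow> 0 \<le> \<rho> x"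
    and start_ge: "\<And>x. x \<in> M \<Longrightarrow> B \<le> f x"
begin

lemma chain_inf_le: "chain_cost \<delta> \<rho> f x c \<Longrightarrow> chain_inf \<delta> \<rho> f x \<le> c"
  unfolding chain_inf_def
  by (intro cInf_lower bdd_belowI[of _ B])
     (use chain_cost_ge start_ge weight_nonneg in blast)+

lemma chain_inf_ge: "x \<in> M \<Longrightarrow> B \<le> chain_inf \<delta> \<rho> f x"
  unfolding chain_inf_def
  by (intro cInf_greatest) (use chain_cost.start chain_cost_ge start_ge weight_nonneg in blast)+

lemma chain_inf_lessD:
  assumes "x \<in> M" "chain_inf \<delta> \<rho> f x < a"
  obtains c where "chain_cost \<delta> \<rho> f x c" "c < a"
  using assms cInf_lessD[of "{c. chain_cost \<delta> \<rho> f x c}" a] chain_cost.start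
  unfolding chain_inf_def by blast

lemma chain_inf_step:
  assumes "x \<in> M" "y \<in> M" "d x y \<le> \<delta>"
  shows "chain_inf \<delta> \<rho> f y \<le> chain_inf \<delta> \<rho> f x + \<rho> x * d x y"
proof (rule field_le_epsilon)
  fix e :: real assume "e > 0"
  then obtain c where "chain_cost \<delta> \<rho> f x c" "c < chain_inf \<delta> \<rho> f x + e"
    using chain_inf_lessD[OF assms(1), of "chain_inf \<delta> \<rho> f x + e"] by auto
  then show "chain_inf \<delta> \<rho> f y \<le> chain_inf \<delta> \<rho> f x + \<rho> x * d x y + e"
    using chain_inf_le[OF chain_cost.extend] assms by fastforce
qed

end

text \<open>A chain ending in the ball of radius \<open>r\<close> around \<open>x\<close> either stays in this ball from its
  start, or enters it for a last time. If after this entry all its points in the annulus between the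
  radii \<open>r / 2\<close> and \<open>r\<close> have weight at least \<open>A\<close>, crossing the annulus costs about \<open>A * r / 2\<close>;
  otherwise a point \<open>p\<close> of smaller weight splits the chain, and from \<open>p\<close> on the chain stays where the
  weight is at least \<open>l\<close>. The \<open>max\<close> in the last alternative makes the statement inductive: it records
  how much of the annulus has been crossed so far.\<close>

lemma chain_cost_annulus:
  assumes x: "x \<in> M" and "A \<ge> 0" "l \<ge> 0"
    and start_ge: "\<And>y. y \<in> M \<Longrightarrow> B \<le> f y"
    and weight_nonneg: "\<And>y. y \<in> M \<Longrightarrow> 0 \<le> \<rho> y"
    and near: "\<And>y. y \<in> mball x r \<Longrightarrow> b \<le> f y \<and> l \<le> \<rho> y"
    and "chain_cost \<delta> \<rho> f z c" "d x z < r"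
  shows "b \<le> c
    \<or> (\<exists>p c'. chain_cost \<delta> \<rho> f p c' \<and> \<rho> p < A \<and> r / 2 \<le> d x p \<and> d x p < r \<and> c' + l * d p z \<le> c)
    \<or> B + A * (r - \<delta> - max (d x z) (r / 2)) \<le> c"
  using assms(7,8)
proof (induction rule: chain_cost.induct)
  case (start z)
  then show ?case using near[of z] x by simp
next
  case (extend y c z)
  have y: "y \<in> M" using extend.hyps by (simp add: chain_cost_in_space)
  have cost_nonneg: "0 \<le> \<rho> y * d y z" using weight_nonneg y by simp
  have tri: "d x z \<le> d x y + d y z" "d x y \<le> d x z + d y z"
    using triangle[OF x y] triangle'[OF x \<open>z \<in> M\<close> y] \<open>z \<in> M\<close> by auto
  show ?case
  proof (cases "d x y < r")
    case False
    \<comment> \<open>The chain has just entered the ball.\<close>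
    then have "r - \<delta> \<le> d x z" using tri extend.hyps by linarith
    then have "A * (r - \<delta> - max (d x z) (r / 2)) \<le> 0"
      using \<open>A \<ge> 0\<close> by (intro mult_nonneg_nonpos) auto
    moreover have "B \<le> c"
      using chain_cost_ge[OF extend.hyps(1) start_ge weight_nonneg] .
    ultimately show ?thesis using cost_nonneg by linarith
  next
    case True
    then have l: "l \<le> \<rho> y" using near[of y] x y by simp
    consider (start) "b \<le> c"
      | (split) p c' where "chain_cost \<delta> \<rho> f p c'" "\<rho> p < A" "r / 2 \<le> d x p" "d x p < r"
          "c' + l * d p y \<le> c"
      | (crossing) "B + A * (r - \<delta> - max (d x y) (r / 2)) \<le> c"
      using extend.IH[OF True] by blast
    then show ?thesis
    proof cases
      case start
      then show ?thesis using cost_nonneg by linarith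
    next
      case split
      have "d p z \<le> d p y + d y z"
        using split(1) y \<open>z \<in> M\<close> by (intro triangle) (auto dest: chain_cost_in_space)
      then have "l * d p z \<le> l * d p y + l * d y z"
        using \<open>l \<ge> 0\<close> by (simp add: distrib_left[symmetric] mult_left_mono)
      also have "l * d y z \<le> \<rho> y * d y z"
        using l by (intro mult_right_mono) auto
      finally show ?thesis using split by (smt (verit, ccfv_SIG))
    next
      case crossing
      consider (inner) "d x y < r / 2" | (light) "r / 2 \<le> d x y" "\<rho> y < A"
        | (heavy) "r / 2 \<le> d x y" "A \<le> \<rho> y" by linarith
      then show ?thesis
      proof cases
        case inner
        have "A * (r - \<delta> - max (d x z) (r / 2)) \<le> A * (r - \<delta> - max (d x y) (r / 2))"
          using inner \<open>A \<ge> 0\<close> by (intro mult_left_mono) auto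
        then show ?thesis using crossing cost_nonneg by linarith
      next
        case light
        have "l * d y z \<le> \<rho> y * d y z"
          using l by (intro mult_right_mono) auto
        then have "chain_cost \<delta> \<rho> f y c \<and> \<rho> y < A \<and> r / 2 \<le> d x y \<and> d x y < r \<and>
            c + l * d y z \<le> c + \<rho> y * d y z"
          using light True extend.hyps(1) by simp
        then show ?thesis by blast
      next
        case heavy
        have "A * (r - \<delta> - max (d x z) (r / 2)) \<le> A * (r - \<delta> - max (d x y) (r / 2) + d y z)"
          using heavy tri \<open>A \<ge> 0\<close> by (intro mult_left_mono) auto
        moreover have "A * d y z \<le> \<rho> y * d y z"
          using heavy by (intro mult_right_mono) auto
        ultimately show ?thesis using crossing by (simp add: distrib_left)
      qed
    qed
  qed
qed

text \<open>The following function is \<open>0\<close> wherever \<open>f\<close> is, since it lies between \<open>0\<close> and \<open>f\<close>: with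
  \<open>u \<le> f \<le> w\<close> for the infimum \<open>u\<close> over chains and the corresponding supremum \<open>w\<close>, it is the median
  of \<open>u\<close>, \<open>0\<close> and \<open>w\<close>. Taking \<open>u\<close> alone would work for \<open>f \<ge> 0\<close> only; treating the positive and
  the negative part of \<open>f\<close> separately and adding the results could double the slope on \<open>{f = 0}\<close>.\<close>

definition chain_median :: "real \<Rightarrow> ('a \<Rightarrow> real) \<Rightarrow> ('a \<Rightarrow> real) \<Rightarrow> 'a \<Rightarrow> real"
  where "chain_median \<delta> \<rho> f x =
    max (chain_inf \<delta> \<rho> f x) (min (- chain_inf \<delta> \<rho> (\<lambda>y. - f y) x) 0)"

context
  fixes \<delta> F :: real and \<rho> f :: "'a \<Rightarrow> real"
  assumes weight_nonneg: "\<And>x. x \<in> M \<Longrightarrow> 0 \<le> \<rho> x"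
    and bound: "\<And>x. x \<in> M \<Longrightarrow> \<bar>f x\<bar> \<le> F"
begin

lemma bound_both_signs: "x \<in> M \<Longrightarrow> - F \<le> f x" "x \<in> M \<Longrightarrow> - F \<le> - f x"
  using bound[of x] by (auto simp: abs_le_iff)

lemma chain_inf_le_start:
  assumes "x \<in> M"
  shows "chain_inf \<delta> \<rho> f x \<le> f x" "chain_inf \<delta> \<rho> (\<lambda>y. - f y) x \<le> - f x"
  using assms by (auto intro!: chain_inf_le[where B = "- F"] chain_cost.start weight_nonneg bound_both_signs)

lemma chain_median_eq_0:
  assumes "x \<in> M" "f x = 0"
  shows "chain_median \<delta> \<rho> f x = 0"
  using chain_inf_le_start[OF assms(1)] assms(2) by (auto simp: chain_median_def)

lemma chain_median_diff_le:
  assumes "x \<in> M"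
  shows "\<bar>chain_median \<delta> \<rho> f x - f x\<bar>
    \<le> max (f x - chain_inf \<delta> \<rho> f x) (- f x - chain_inf \<delta> \<rho> (\<lambda>y. - f y) x)"
  using chain_inf_le_start[OF assms] unfolding chain_median_def by linarith

lemma chain_median_bound:
  assumes "x \<in> M"
  shows "\<bar>chain_median \<delta> \<rho> f x\<bar> \<le> F"
  using chain_inf_le_start[OF assms] bound[OF assms]
    chain_inf_ge[where \<rho> = \<rho> and \<delta> = \<delta>, OF weight_nonneg bound_both_signs(1) assms]
    chain_inf_ge[where \<rho> = \<rho> and \<delta> = \<delta>, OF weight_nonneg bound_both_signs(2) assms]
  unfolding chain_median_def by linarith

lemma chain_median_step:
  assumes "x \<in> M" "y \<in> M" "d x y \<le> \<delta>"
  shows "\<bar>chain_median \<delta> \<rho> f x - chain_median \<delta> \<rho> f y\<bar> \<le> max (\<rho> x) (\<rho> y) * d x y"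
proof -
  have *: "chain_inf \<delta> \<rho> h x - chain_inf \<delta> \<rho> h y \<le> max (\<rho> x) (\<rho> y) * d x y"
    if "x \<in> M" "y \<in> M" "d x y \<le> \<delta>" "\<And>z. z \<in> M \<Longrightarrow> - F \<le> h z" for h x y
  proof -
    have "\<rho> y * d y x \<le> max (\<rho> x) (\<rho> y) * d x y"
      unfolding commute[of y x] by (rule mult_right_mono) auto
    then show ?thesis
      using chain_inf_step[where \<rho> = \<rho> and \<delta> = \<delta> and f = h, OF weight_nonneg that(4,2,1)] that(3) commute[of x y] by simp
  qed
  have "d y x \<le> \<delta>" using assms(3) commute[of x y] by simp
  then show ?thesis
    using *[of _ _ f, OF assms bound_both_signs(1)] *[of _ _ "\<lambda>z. - f z", OF assms bound_both_signs(2)]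
      *[of _ _ f, OF assms(2,1) _ bound_both_signs(1)] *[of _ _ "\<lambda>z. - f z", OF assms(2,1) _ bound_both_signs(2)]
    unfolding chain_median_def commute[of y x] max.commute[of "\<rho> y"] by linarith
qed

text \<open>The bound on \<open>\<rho>\<close> is a Lipschitz constant at distances up to \<open>\<delta>\<close>. Beyond this scale only
  boundedness of the function helps, so the global Lipschitz constant may blow up as \<open>\<delta>\<close> tends
  to \<open>0\<close>.\<close>

lemma chain_median_LIP:
  assumes "\<delta> > 0" "\<And>x. x \<in> M \<Longrightarrow> \<rho> x \<le> C"
  shows "chain_median \<delta> \<rho> f \<in> LIP"
  unfolding LIP_iff
proof (intro exI[of _ "max \<bar>C\<bar> (2 * \<bar>F\<bar> / \<delta>)"] conjI ballI)
  fix x y assume xy: "x \<in> M" "y \<in> M"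
  show "\<bar>chain_median \<delta> \<rho> f x - chain_median \<delta> \<rho> f y\<bar> \<le> max \<bar>C\<bar> (2 * \<bar>F\<bar> / \<delta>) * d x y"
  proof (cases "d x y \<le> \<delta>")
    case True
    have "max (\<rho> x) (\<rho> y) \<le> max \<bar>C\<bar> (2 * \<bar>F\<bar> / \<delta>)"
      using assms(2)[of x] assms(2)[of y] xy by linarith
    then have "max (\<rho> x) (\<rho> y) * d x y \<le> max \<bar>C\<bar> (2 * \<bar>F\<bar> / \<delta>) * d x y"
      by (rule mult_right_mono) simp
    with chain_median_step[OF xy True] show ?thesis by linarith
  next
    case False
    have "\<bar>chain_median \<delta> \<rho> f x - chain_median \<delta> \<rho> f y\<bar> \<le> 2 * \<bar>F\<bar> / \<delta> * \<delta>"
      using chain_median_bound[OF xy(1)] chain_median_bound[OF xy(2)] \<open>\<delta> > 0\<close> by simp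
    also have "\<dots> \<le> max \<bar>C\<bar> (2 * \<bar>F\<bar> / \<delta>) * d x y"
      using False \<open>\<delta> > 0\<close> by (intro mult_mono) auto
    finally show ?thesis .
  qed
qed simp

text \<open>Around \<open>x\<close> only one-step chains matter, so the slope at \<open>x\<close> is controlled by the weight
  near \<open>x\<close>, whatever the weight is elsewhere.\<close>

lemma lip_a_chain_median_le:
  assumes "chain_median \<delta> \<rho> f \<in> LIP" "\<delta> > 0" "continuous_map mtopology euclideanreal \<rho>" "x \<in> M"
  shows "lip_a (chain_median \<delta> \<rho> f) x \<le> \<rho> x"
proof (rule field_le_epsilon)
  fix e :: real assume "e > 0"
  then obtain r where r: "r > 0" "\<And>y. y \<in> mball x r \<Longrightarrow> \<bar>\<rho> y - \<rho> x\<bar> < e"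
    using assms(3,4) unfolding continuous_map_real_iff by blast
  define s where "s = min r (\<delta> / 2)"
  have s: "s > 0" "s \<le> r" "s \<le> \<delta> / 2" using r assms by (auto simp: s_def)
  have "Lip (chain_median \<delta> \<rho> f) (mball x s) \<le> \<rho> x + e"
  proof (rule Lip_le)
    fix y z assume yz: "y \<in> mball x s" "z \<in> mball x s"
    then have "d y z \<le> \<delta>"
      using triangle''[of y x z] s by simp
    then have "\<bar>chain_median \<delta> \<rho> f y - chain_median \<delta> \<rho> f z\<bar> \<le> max (\<rho> y) (\<rho> z) * d y z"
      using yz by (intro chain_median_step) auto
    also have "\<dots> \<le> (\<rho> x + e) * d y z"
      using r(2)[of y] r(2)[of z] yz s by (intro mult_right_mono) auto
    finally show "\<bar>chain_median \<delta> \<rho> f y - chain_median \<delta> \<rho> f z\<bar> \<le> (\<rho> x + e) * d y z" .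
  qed (use \<open>e > 0\<close> weight_nonneg[OF \<open>x \<in> M\<close>] in \<open>auto simp: mball_subset_mspace\<close>)
  with lip_a_le_Lip_mball[OF assms(1) s(1)] show "lip_a (chain_median \<delta> \<rho> f) x \<le> \<rho> x + e"
    by (rule order_trans)
qed

end

end

section \<open>Convergence of the chain infima\<close>

locale approximating_distances = Metric_space M d
  for M :: "'a set" and d :: "'a \<Rightarrow> 'a \<Rightarrow> real" +
  fixes di :: "nat \<Rightarrow> 'a \<Rightarrow> 'a \<Rightarrow> real"
  assumes di_metric: "\<And>i. Metric_space M (di i)"
    and di_Suc: "\<And>i x y. x \<in> M \<Longrightarrow> y \<in> M \<Longrightarrow> di i x y \<le> di (Suc i) x y"
    and di_tendsto: "\<And>x y. x \<in> M \<Longrightarrow> y \<in> M \<Longrightarrow> (\<lambda>i. di i x y) \<longlonglongrightarrow> d x y"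
    and di_topology: "\<And>i. Metric_space.mtopology M (di i) = mtopology"
begin

lemma di_mono: "x \<in> M \<Longrightarrow> y \<in> M \<Longrightarrow> i \<le> j \<Longrightarrow> di i x y \<le> di j x y"
  by (rule lift_Suc_mono_le[of "\<lambda>i. di i x y"]) (use di_Suc in auto)

lemma di_le: "x \<in> M \<Longrightarrow> y \<in> M \<Longrightarrow> di i x y \<le> d x y"
  by (rule incseq_le[of "\<lambda>i. di i x y"]) (auto intro!: incseq_SucI di_Suc di_tendsto)

text \<open>One radius serves all \<open>i\<close>, because the \<open>di i\<close>-balls shrink as \<open>i\<close> grows.\<close>

lemma ball_contains_di_ball:
  assumes "x \<in> M" "s > 0"
  obtains r where "r > 0" "\<And>i y. y \<in> M \<Longrightarrow> di i x y < r \<Longrightarrow> d x y < s"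
proof -
  interpret D0: Metric_space M "di 0" by (rule di_metric)
  have "openin D0.mtopology (mball x s)"
    unfolding di_topology by (rule openin_mball)
  then obtain r where r: "r > 0" "D0.mball x r \<subseteq> mball x s"
    unfolding D0.openin_mtopology using assms by (metis centre_in_mball_iff)
  have "d x y < s" if "y \<in> M" "di i x y < r" for i y
    using di_mono[of x y 0 i] that r(2) assms by (auto simp: subset_iff)
  with r(1) that show thesis by blast
qed

end

text \<open>The weights \<open>\<rho> i\<close> are locally at least a Lipschitz constant of \<open>f\<close> with respect to \<open>d\<close>.
  By the coercivity condition, in which \<open>K\<close> does not depend on \<open>i\<close>, points at which the weights stay
  bounded as \<open>i\<close> grows form a totally bounded sequence; this makes up for the lack of uniformity in
  \<open>di i \<longlonglongrightarrow> d\<close> on noncompact sets.\<close>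

locale weighted_approximation = approximating_distances M d di
  for M :: "'a set" and d di +
  fixes f :: "'a \<Rightarrow> real" and \<rho> :: "nat \<Rightarrow> 'a \<Rightarrow> real" and F e :: real
  assumes complete: mcomplete
    and f_bound: "\<And>x. x \<in> M \<Longrightarrow> \<bar>f x\<bar> \<le> F"
    and e_pos: "e > 0"
    and weight_nonneg: "\<And>i x. x \<in> M \<Longrightarrow> 0 \<le> \<rho> i x"
    and weight_local: "\<And>x. x \<in> M \<Longrightarrow>
      \<exists>l\<ge>e. \<exists>r>0. \<forall>y\<in>mball x r. \<bar>f x - f y\<bar> \<le> l * d x y \<and> (\<forall>i. l \<le> \<rho> i y)"
    and weight_coercive: "\<And>j. \<exists>K. finite K \<and> K \<subseteq> M \<and>
      (\<forall>i\<ge>j. \<forall>x\<in>M. \<rho> i x < real j \<longrightarrow> (\<exists>y\<in>K. d y x < 2 / real (Suc j)))"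
begin

abbreviation chain_inf_at :: "nat \<Rightarrow> 'a \<Rightarrow> real" where
  "chain_inf_at i \<equiv> Metric_space.chain_inf M (di i) (1 / real (Suc i)) (\<rho> i) f"

lemma f_ge: "x \<in> M \<Longrightarrow> - F \<le> f x"
  using f_bound[of x] by (simp add: abs_le_iff)

text \<open>The epigraph of the lower \<open>\<Gamma>\<close>-limit of the chain infima.\<close>

definition limit_epigraph :: "'a \<Rightarrow> real \<Rightarrow> bool" where
  "limit_epigraph x a \<longleftrightarrow> (\<forall>t>0. \<forall>N. \<exists>i\<ge>N. \<exists>z\<in>M. d z x < t \<and> chain_inf_at i z < a + t)"

lemma limit_epigraph_closed:
  assumes "x \<in> M" and near: "\<And>t. t > 0 \<Longrightarrow> \<exists>y\<in>M. \<exists>b. limit_epigraph y b \<and> d y x < t \<and> \<bar>b - a\<bar> < t"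
  shows "limit_epigraph x a"
  unfolding limit_epigraph_def
proof (intro allI impI)
  fix t :: real and N assume "t > 0"
  then obtain y b where y: "y \<in> M" "limit_epigraph y b" "d y x < t / 2" "\<bar>b - a\<bar> < t / 2"
    using near[of "t / 2"] by auto
  then obtain i z where z: "i \<ge> N" "z \<in> M" "d z y < t / 2" "chain_inf_at i z < b + t / 2"
    using \<open>t > 0\<close> unfolding limit_epigraph_def by (metis half_gt_zero)
  have "d z x < t" using triangle[of z y x] y z assms(1) by linarith
  moreover have "chain_inf_at i z < a + t" using y z by linarith
  ultimately show "\<exists>i\<ge>N. \<exists>z\<in>M. d z x < t \<and> chain_inf_at i z < a + t"
    using z by blast
qed

lemma limit_epigraph_ge:
  assumes "limit_epigraph x a"
  shows "- F \<le> a"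
proof (rule field_le_epsilon)
  fix t :: real assume "t > 0"
  then obtain i z where z: "z \<in> M" "chain_inf_at i z < a + t"
    using assms unfolding limit_epigraph_def by meson
  have "- F \<le> chain_inf_at i z"
    by (rule Metric_space.chain_inf_ge[OF di_metric weight_nonneg f_ge z(1)])
  with z show "- F \<le> a + t" by simp
qed

text \<open>The set \<open>{x. \<rho> i x < j}\<close> is covered by finitely many balls of radius \<open>2 / (k + 1)\<close> for every
  \<open>k \<ge> j\<close> with \<open>k \<le> i\<close>, so any scale is eventually available along the sequence.\<close>

lemma light_points_convergent:
  assumes p: "\<And>n. p n \<in> M" "\<And>n. \<rho> (\<iota> n) (p n) < real j" and \<iota>: "\<And>n. n \<le> \<iota> n"
  obtains q \<sigma> where "q \<in> M" "strict_mono \<sigma>" "(\<lambda>n. d (p (\<sigma> n)) q) \<longlonglongrightarrow> 0"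
proof -
  have "\<exists>K. finite K \<and> K \<subseteq> M \<and> range p \<subseteq> (\<Union>y\<in>K. mball y t)" if "t > 0" for t
  proof -
    obtain k0 :: nat where k0: "2 / t < real k0" using reals_Archimedean2 by blast
    define k where "k = max j k0"
    have k: "j \<le> k" "2 / real (Suc k) < t"
    proof -
      show "j \<le> k" by (simp add: k_def)
      have "2 / t < real (Suc k)" using k0 by (simp add: k_def)
      then show "2 / real (Suc k) < t"
        using \<open>t > 0\<close> by (simp add: pos_divide_less_eq mult.commute del: of_nat_Suc)
    qed
    obtain K where K: "finite K" "K \<subseteq> M"
      "\<And>i x. i \<ge> k \<Longrightarrow> x \<in> M \<Longrightarrow> \<rho> i x < real k \<Longrightarrow> \<exists>y\<in>K. d y x < 2 / real (Suc k)"
      using weight_coercive[of k] by blast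
    have late: "p n \<in> (\<Union>y\<in>K. mball y t)" if "n \<ge> k" for n
    proof -
      have "\<rho> (\<iota> n) (p n) < real k" using p(2)[of n] k(1) by simp
      then obtain y where "y \<in> K" "d y (p n) < 2 / real (Suc k)"
        using K(3)[of "\<iota> n" "p n"] p(1) \<iota>[of n] \<open>n \<ge> k\<close> by auto
      moreover from this have "p n \<in> mball y t"
        using k(2) K(2) p(1)[of n] by auto
      ultimately show ?thesis by blast
    qed
    have early: "p n \<in> (\<Union>y\<in>p ` {..<k}. mball y t)" if "n < k" for n
      using that p(1) \<open>t > 0\<close> by (intro UN_I[of "p n"]) auto
    have "p n \<in> (\<Union>y\<in>K \<union> p ` {..<k}. mball y t)" for n
      unfolding UN_Un using late[of n] early[of n] by (meson UnCI not_less)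
    then have "range p \<subseteq> (\<Union>y\<in>K \<union> p ` {..<k}. mball y t)"
      by (rule image_subsetI)
    with K p(1) show ?thesis
      by (intro exI[of _ "K \<union> p ` {..<k}"]) auto
  qed
  then have "mtotally_bounded (range p)"
    using p(1) by (intro mtotally_boundedI) auto
  then obtain \<sigma> where \<sigma>: "strict_mono \<sigma>" "MCauchy (p \<circ> \<sigma>)"
    unfolding mtotally_bounded_sequentially by blast
  then obtain q where "limitin mtopology (p \<circ> \<sigma>) q sequentially"
    using complete unfolding mcomplete_def by blast
  with \<sigma> that show thesis
    unfolding limitin_metric_dist_null by auto
qed

text \<open>Chains realising the value \<open>a < f x\<close> near \<open>x\<close> cannot start near \<open>x\<close>, because \<open>f\<close> is
  continuous. Hence they cross a small annulus around \<open>x\<close>, and they do so through points of bounded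
  weight, which accumulate at some \<open>q\<close>. Since the \<open>di\<close>-distances from \<open>x\<close> to these points
  converge to \<open>d x q\<close>, the chains pay for the remaining way to \<open>x\<close> at least the local Lipschitz
  constant of \<open>f\<close> times \<open>d x q\<close>, so that the gap to \<open>f\<close> is at least as large at \<open>q\<close>.\<close>

lemma limit_epigraph_descent:
  assumes x: "x \<in> M" and a: "limit_epigraph x a" "a < f x"
  obtains q b where "q \<in> M" "limit_epigraph q b" "b < a" "b \<le> a - e * d x q" "f x - f q \<le> a - b"
proof -
  obtain l r0 where l: "l \<ge> e" "r0 > 0"
    "\<And>y. y \<in> mball x r0 \<Longrightarrow> \<bar>f x - f y\<bar> \<le> l * d x y"
    "\<And>i y. y \<in> mball x r0 \<Longrightarrow> l \<le> \<rho> i y"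
    using weight_local[OF x] by metis
  have "l > 0" using l e_pos by simp
  \<comment> \<open>On the ball of radius \<open>s\<close> the values of \<open>f\<close> stay above the midpoint of \<open>a\<close> and \<open>f x\<close>.\<close>
  define s where "s = min r0 ((f x - a) / (2 * l))"
  have s: "s > 0" "s \<le> r0" "l * s \<le> (f x - a) / 2"
    using l a \<open>l > 0\<close> by (auto simp: s_def min_def field_simps)
  obtain r' where r': "r' > 0" "\<And>i y. y \<in> M \<Longrightarrow> di i x y < r' \<Longrightarrow> d x y < s"
    using ball_contains_di_ball[OF x s(1)] by blast
  define r where "r = r' / 2"
  have r: "r > 0" "r < r'" using r' by (auto simp: r_def)
  have near: "(f x + a) / 2 \<le> f y \<and> l \<le> \<rho> i y" if "y \<in> M" "di i x y < r" for i y
  proof -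
    have dy: "d x y < s" using r'(2)[OF that(1), of i] that(2) r(2) by simp
    then have y: "y \<in> mball x r0" using x that s by simp
    have "l * d x y \<le> l * s" using dy \<open>l > 0\<close> by simp
    then have "f x - f y \<le> (f x - a) / 2"
      using l(3)[OF y] s(3) by linarith
    then show ?thesis
      using l(4)[OF y] by (simp add: field_simps)
  qed
  \<comment> \<open>Crossing the annulus with weight \<open>j\<close> would cost more than \<open>a + 1 + F\<close>, while chains start at
    values of \<open>f\<close> not below \<open>- F\<close>.\<close>
  obtain j :: nat where j: "(a + 1 + F) / (r / 8) < real j"
    using reals_Archimedean2 by blast
  obtain n0 :: nat where n0: "8 / r + 2 / (f x - a) < real n0"
    using reals_Archimedean2 by blast
  have "\<exists>i z p c. n + n0 \<le> i \<and> z \<in> M \<and> d z x < 1 / real (Suc (n + n0)) \<and>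
      Metric_space.chain_cost M (di i) (1 / real (Suc i)) (\<rho> i) f p c \<and>
      \<rho> i p < real j \<and> r / 2 \<le> di i x p \<and> di i x p < r \<and>
      c + l * di i p z < a + 1 / real (Suc (n + n0))" for n
  proof -
    define t where "t = 1 / real (Suc (n + n0))"
    have "8 / r < real (Suc (n + n0))" "2 / (f x - a) < real (Suc (n + n0))"
      using n0 r a divide_pos_pos[of 8 r] divide_pos_pos[of 2 "f x - a"] by linarith+
    then have t: "0 < t" "t < r / 8" "t < (f x - a) / 2" "t \<le> 1"
      using r a by (auto simp: t_def field_simps)
    obtain i z where i: "n + n0 \<le> i" and z: "z \<in> M" "d z x < t" "chain_inf_at i z < a + t"
      using a(1) t(1) unfolding limit_epigraph_def by blast
    interpret Di: Metric_space M "di i" by (rule di_metric)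
    obtain c where c: "Di.chain_cost (1 / real (Suc i)) (\<rho> i) f z c" "c < a + t"
      by (rule Di.chain_inf_lessD[OF weight_nonneg f_ge z(1,3)])
    have mesh: "1 / real (Suc i) \<le> t"
      using i by (simp add: t_def frac_le)
    have dz: "di i x z < r / 8" "di i x z < t"
      using di_le[OF x z(1), of i] z(2) t commute[of x z] by linarith+
    have "(f x + a) / 2 \<le> c
      \<or> (\<exists>p c'. Di.chain_cost (1 / real (Suc i)) (\<rho> i) f p c' \<and> \<rho> i p < real j \<and>
            r / 2 \<le> di i x p \<and> di i x p < r \<and> c' + l * di i p z \<le> c)
      \<or> - F + real j * (r - 1 / real (Suc i) - max (di i x z) (r / 2)) \<le> c"
    proof (rule Di.chain_cost_annulus[OF x _ _ f_ge weight_nonneg _ c(1)])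
      fix y assume "y \<in> Di.mball x r"
      then show "(f x + a) / 2 \<le> f y \<and> l \<le> \<rho> i y" using near[of y i] by simp
    next
      show "di i x z < r" using dz(1) r(1) by linarith
    qed (use \<open>l > 0\<close> in auto)
    moreover have "c < (f x + a) / 2"
      using c(2) t(3) by (simp add: field_simps)
    moreover have "c < - F + real j * (r - 1 / real (Suc i) - max (di i x z) (r / 2))"
    proof -
      have "a + 1 + F < real j * (r / 8)"
        using j r(1) by (simp add: pos_divide_less_eq)
      also have "\<dots> \<le> real j * (r - 1 / real (Suc i) - max (di i x z) (r / 2))"
        using mesh t dz r(1) by (intro mult_left_mono) auto
      finally show ?thesis using c(2) t(4) by linarith
    qed
    ultimately obtain p c' where "Di.chain_cost (1 / real (Suc i)) (\<rho> i) f p c'"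
      "\<rho> i p < real j" "r / 2 \<le> di i x p" "di i x p < r" "c' + l * di i p z \<le> c"
      by (meson not_less)
    then show ?thesis
      using i z c(2) unfolding t_def by (intro exI[of _ i] exI[of _ z] exI[of _ p] exI[of _ c']) auto
  qed
  then obtain \<iota> z p c where *: "\<And>n. n + n0 \<le> \<iota> n" "\<And>n. z n \<in> M"
      "\<And>n. d (z n) x < 1 / real (Suc (n + n0))"
      "\<And>n. Metric_space.chain_cost M (di (\<iota> n)) (1 / real (Suc (\<iota> n))) (\<rho> (\<iota> n)) f (p n) (c n)"
      "\<And>n. \<rho> (\<iota> n) (p n) < real j" "\<And>n. r / 2 \<le> di (\<iota> n) x (p n)" "\<And>n. di (\<iota> n) x (p n) < r"
      "\<And>n. c n + l * di (\<iota> n) (p n) (z n) < a + 1 / real (Suc (n + n0))"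
    by metis
  have p: "p n \<in> M" for n
    by (rule Metric_space.chain_cost_in_space[OF di_metric *(4)])
  have index_ge: "n \<le> \<iota> n" for n using *(1)[of n] by simp
  obtain q \<sigma> where q: "q \<in> M" "strict_mono \<sigma>" "(\<lambda>n. d (p (\<sigma> n)) q) \<longlonglongrightarrow> 0"
    using light_points_convergent[where p = p and \<iota> = \<iota> and j = j, OF p *(5) index_ge] by blast
  have \<sigma>_ge: "n \<le> \<sigma> n" for n using q(2) by (rule strict_mono_imp_increasing)
  have cost: "chain_inf_at (\<iota> n) (p n) \<le> c n" for n
    by (rule Metric_space.chain_inf_le[OF di_metric weight_nonneg f_ge *(4)])
  have far: "r / 2 \<le> d x q"
  proof -
    have "r / 2 - d (p (\<sigma> n)) q \<le> d x q" for n
      using *(6)[of "\<sigma> n"] di_le[OF x p, of "\<iota> (\<sigma> n)" "\<sigma> n"] triangle'[OF x q(1) p, of "\<sigma> n"]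
      by linarith
    moreover have "(\<lambda>n. r / 2 - d (p (\<sigma> n)) q) \<longlonglongrightarrow> r / 2"
      using tendsto_diff[OF tendsto_const q(3), of "r / 2"] by simp
    ultimately show ?thesis by (intro LIMSEQ_le_const2) auto
  qed
  have q_near: "q \<in> mball x r0"
  proof -
    have "di 0 x q \<le> r + d (p (\<sigma> n)) q" for n
      using Metric_space.triangle[OF di_metric x p q(1), of 0 "\<sigma> n"] *(7)[of "\<sigma> n"]
        di_mono[OF x p, of 0 "\<iota> (\<sigma> n)" "\<sigma> n"] di_le[OF p q(1), of 0 "\<sigma> n"] by linarith
    moreover have "(\<lambda>n. r + d (p (\<sigma> n)) q) \<longlonglongrightarrow> r"
      using tendsto_add[OF tendsto_const q(3), of r] by simp
    ultimately have "di 0 x q \<le> r" by (intro LIMSEQ_le_const) auto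
    then have "d x q < s" using r'(2)[OF q(1), of 0] r(2) by simp
    then show ?thesis using x q(1) s(2) by simp
  qed
  have "limit_epigraph q (a - l * d x q)"
    unfolding limit_epigraph_def
  proof (intro allI impI)
    fix t :: real and N assume "t > 0"
    \<comment> \<open>The estimate below loses \<open>t'\<close> in the cost and \<open>3 * t'\<close> in the distance, weighted by \<open>l\<close>.\<close>
    define t' where "t' = t / (2 + 3 * l)"
    have t': "t' > 0" "t' * (2 + 3 * l) = t" using \<open>t > 0\<close> \<open>l > 0\<close> by (auto simp: t'_def)
    obtain k where k: "d x q - t' < di k x q"
      using order_tendstoD(1)[OF di_tendsto[OF x q(1)], of "d x q - t'"] t'
      unfolding eventually_sequentially by auto
    have "(\<lambda>n. 1 / real (Suc n)) \<longlonglongrightarrow> 0" by (rule LIMSEQ_Suc) (rule lim_1_over_n)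
    then have "eventually (\<lambda>n. d (p (\<sigma> n)) q < t' \<and> 1 / real (Suc n) < t' \<and> N \<le> n \<and> k \<le> n) sequentially"
      using t' q(3) by (intro eventually_conj order_tendstoD(2) eventually_ge_at_top) auto
    then obtain n where n: "d (p (\<sigma> n)) q < t'" "1 / real (Suc n) < t'" "N \<le> n" "k \<le> n"
      unfolding eventually_sequentially by blast
    define m where "m = \<sigma> n"
    have m: "n \<le> m" "n \<le> \<iota> m" using \<sigma>_ge[of n] *(1)[of m] by (auto simp: m_def)
    have "1 / real (Suc (m + n0)) \<le> 1 / real (Suc n)" using m by (simp add: frac_le)
    then have small: "1 / real (Suc (m + n0)) < t'" using n by linarith
    interpret Di: Metric_space M "di (\<iota> m)" by (rule di_metric)
    have "d x q - t' < di (\<iota> m) x q"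
      using k di_mono[OF x q(1), of k "\<iota> m"] n m by simp
    also have "\<dots> \<le> di (\<iota> m) x (z m) + di (\<iota> m) (z m) (p m) + di (\<iota> m) (p m) q"
      using Di.triangle[OF x p q(1), of m] Di.triangle[OF x *(2) p, of m m] by linarith
    also have "\<dots> \<le> t' + di (\<iota> m) (p m) (z m) + t'"
      using di_le[OF *(2) x, of "\<iota> m" m] *(3)[of m] small di_le[OF p q(1), of "\<iota> m" m] n(1)
        Di.commute[of x "z m"] Di.commute[of "z m" "p m"] unfolding m_def by linarith
    finally have "l * (d x q - 3 * t') \<le> l * di (\<iota> m) (p m) (z m)"
      using \<open>l > 0\<close> by (intro mult_left_mono) auto
    then have "c m < a - l * d x q + t"
      using *(8)[of m] small t' by (simp add: algebra_simps)
    then have "chain_inf_at (\<iota> m) (p m) < a - l * d x q + t"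
      using cost[of m] by linarith
    moreover have "d (p m) q < t"
    proof -
      have "t' * 1 \<le> t' * (2 + 3 * l)" using t' \<open>l > 0\<close> by (intro mult_left_mono) auto
      with n(1) t' show ?thesis by (simp add: m_def)
    qed
    ultimately show "\<exists>i\<ge>N. \<exists>z\<in>M. d z q < t \<and> chain_inf_at i z < a - l * d x q + t"
      using m n p by (meson order_trans)
  qed
  moreover have "a - l * d x q < a"
    using far r(1) \<open>l > 0\<close> by simp
  moreover have "a - l * d x q \<le> a - e * d x q"
    using l(1) by (intro diff_left_mono mult_right_mono) auto
  moreover have "f x - f q \<le> a - (a - l * d x q)"
    using l(3)[OF q_near] by linarith
  ultimately show thesis by (rule that[OF q(1)])
qed

lemma f_continuous_at:
  assumes "x \<in> M" "t > 0"
  obtains r where "r > 0" "\<And>y. y \<in> mball x r \<Longrightarrow> \<bar>f y - f x\<bar> < t"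
proof -
  obtain l r0 where l0: "l \<ge> e" and r0: "r0 > 0"
    and l: "\<forall>y\<in>mball x r0. \<bar>f x - f y\<bar> \<le> l * d x y \<and> (\<forall>i. l \<le> \<rho> i y)"
    using weight_local[OF assms(1)] by blast
  have "l > 0" using l0 e_pos by simp
  have "\<bar>f y - f x\<bar> < t" if y: "y \<in> mball x (min r0 (t / l))" for y
  proof -
    have "\<bar>f x - f y\<bar> \<le> l * d x y"
      using l y by simp
    also have "\<dots> < t"
      using y \<open>l > 0\<close> by (simp add: pos_less_divide_eq mult.commute)
    finally show ?thesis by (simp add: abs_minus_commute)
  qed
  then show thesis
    using that[of "min r0 (t / l)"] r0 \<open>l > 0\<close> assms(2) by simp
qed

proposition chain_inf_tendsto:
  assumes x: "x \<in> M"
  shows "(\<lambda>i. chain_inf_at i x) \<longlonglongrightarrow> f x"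
proof -
  have le: "chain_inf_at i x \<le> f x" for i
  proof -
    interpret Di: Metric_space M "di i" by (rule di_metric)
    show ?thesis
      using x by (auto intro!: Di.chain_inf_le[where B = "- F"] Di.chain_cost.start weight_nonneg f_ge)
  qed
  have "eventually (\<lambda>i. f x - t < chain_inf_at i x) sequentially" if "t > 0" for t
  proof (rule ccontr)
    assume "\<not> ?thesis"
    then have bad: "\<exists>i\<ge>N. chain_inf_at i x \<le> f x - t" for N
      unfolding eventually_sequentially by (meson not_less)
    have "limit_epigraph x (f x - t)"
      unfolding limit_epigraph_def
    proof (intro allI impI)
      fix s :: real and N assume "s > 0"
      moreover obtain i where "i \<ge> N" "chain_inf_at i x \<le> f x - t" using bad by blast
      ultimately show "\<exists>i\<ge>N. \<exists>z\<in>M. d z x < s \<and> chain_inf_at i z < f x - t + s"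
        using x by (intro exI[of _ i] conjI bexI[of _ x]) auto
    qed
    moreover have "\<not> (limit_epigraph x a \<and> a \<le> f x - t)" for a
    proof (rule no_perpetual_descent[OF complete e_pos, where B = "- F" and
          P = "\<lambda>x a. limit_epigraph x a \<and> a \<le> f x - t"])
      fix x a
      assume x: "x \<in> M" and
        near: "\<And>s. s > 0 \<Longrightarrow>
          \<exists>y\<in>M. \<exists>b. (limit_epigraph y b \<and> b \<le> f y - t) \<and> d y x < s \<and> \<bar>b - a\<bar> < s"
      have "limit_epigraph x a"
        by (rule limit_epigraph_closed[OF x]) (use near in blast)
      moreover have "a \<le> f x - t"
      proof (rule field_le_epsilon)
        fix s :: real assume "s > 0"
        then obtain r where r: "r > 0" "\<And>y. y \<in> mball x r \<Longrightarrow> \<bar>f y - f x\<bar> < s / 2"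
          using f_continuous_at[OF x, of "s / 2"] by auto
        obtain y b where y: "y \<in> M" "b \<le> f y - t" "d y x < min r (s / 2)" "\<bar>b - a\<bar> < min r (s / 2)"
          using near[of "min r (s / 2)"] r(1) \<open>s > 0\<close> by auto
        then have "\<bar>f y - f x\<bar> < s / 2" using r(2)[of y] x commute[of x y] by auto
        moreover have "\<bar>b - a\<bar> < s / 2" using y(4) by simp
        ultimately show "a \<le> f x - t + s" using y(2) by linarith
      qed
      ultimately show "limit_epigraph x a \<and> a \<le> f x - t" ..
    next
      fix x a assume "limit_epigraph x a \<and> a \<le> f x - t"
      then show "- F \<le> a" using limit_epigraph_ge by blast
    next
      fix x a assume xa: "x \<in> M" "limit_epigraph x a \<and> a \<le> f x - t"
      then obtain q b where "q \<in> M" "limit_epigraph q b" "b < a" "b \<le> a - e * d x q" "f x - f q \<le> a - b"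
        using limit_epigraph_descent[of x a] \<open>t > 0\<close> by auto
      then show "\<exists>y\<in>M. \<exists>b. (limit_epigraph y b \<and> b \<le> f y - t) \<and> b < a \<and> b \<le> a - e * d x y"
        using xa by (intro bexI[of _ q] exI[of _ b]) auto
    qed (rule x)
    ultimately show False by blast
  qed
  note * = this
  show ?thesis
  proof (rule order_tendstoI)
    fix a assume "a < f x"
    then show "eventually (\<lambda>i. a < chain_inf_at i x) sequentially"
      using *[of "f x - a"] by simp
  next
    fix a assume "f x < a"
    then show "eventually (\<lambda>i. chain_inf_at i x < a) sequentially"
      using le by (intro always_eventually allI) (rule le_less_trans)
  qed
qed

end

section \<open>Construction of the weights\<close>

context metric_measure_space
begin

lemma openin_measurable: "openin mtopology U \<Longrightarrow> U \<in> sets \<mm>"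
  by (simp add: borel sigma_sets.Basic)

lemma closedin_measurable: "closedin mtopology S \<Longrightarrow> S \<in> sets \<mm>"
  using openin_measurable[of "M - S"] sets.compl_sets[of "M - S" \<mm>]
  by (simp add: closedin_def space_eq double_diff)

lemma continuous_map_measurable:
  assumes "continuous_map mtopology euclideanreal h"
  shows "h \<in> borel_measurable \<mm>"
proof (rule borel_measurableI)
  fix T :: "real set" assume "open T"
  then have "openin mtopology {x \<in> topspace mtopology. h x \<in> T}"
    using assms by (intro openin_continuous_map_preimage) auto
  moreover have "{x \<in> topspace mtopology. h x \<in> T} = h -` T \<inter> space \<mm>"
    by (auto simp: space_eq)
  ultimately show "h -` T \<inter> space \<mm> \<in> sets \<mm>"
    by (metis openin_measurable)
qed

lemma lip_a_measurable:
  assumes "f \<in> LIP"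
  shows "lip_a f \<in> borel_measurable \<mm>"
proof (subst borel_measurable_iff_less, intro allI)
  fix c
  have "openin mtopology {x \<in> M. lip_a f x < c}"
    unfolding openin_mtopology
  proof (intro conjI allI impI)
    fix x assume "x \<in> {x \<in> M. lip_a f x < c}"
    then obtain r where "r > 0" "\<And>y. y \<in> mball x r \<Longrightarrow> lip_a f y < c"
      using lip_a_less_near[OF assms] by blast
    then show "\<exists>r>0. mball x r \<subseteq> {x \<in> M. lip_a f x < c}"
      using mball_subset_mspace by (intro exI[of _ r]) blast
  qed auto
  then show "{x \<in> space \<mm>. lip_a f x < c} \<in> sets \<mm>"
    unfolding space_eq by (rule openin_measurable)
qed

text \<open>Since the slope is bounded and upper semicontinuous, the functions
  \<open>x \<mapsto> SUP y. lip_a f y - n * d x y\<close> are Lipschitz and decrease to it. The margin \<open>2 * e\<close> leaves room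
  for a Lipschitz constant of \<open>f\<close> on a small ball, which may exceed the slope at the centre, and for the
  oscillation of \<open>\<theta>\<close> on that ball.\<close>

lemma slope_continuous_majorant:
  assumes f: "f \<in> LIP" and "M \<noteq> {}" and S: "S \<in> sets \<mm>" "emeasure \<mm> S < \<infinity>"
    and "p > 0" "\<epsilon> > 0"
  obtains \<theta> e C where "e > 0" "continuous_map mtopology euclideanreal \<theta>"
    "\<And>x. x \<in> M \<Longrightarrow> \<theta> x \<le> C" "\<And>x. x \<in> M \<Longrightarrow> lip_a f x + 2 * e \<le> \<theta> x"
    "(\<integral>\<^sup>+x. ennreal (\<theta> x powr p) * indicator S x \<partial>\<mm>)
      \<le> (\<integral>\<^sup>+x. ennreal (lip_a f x powr p) * indicator S x \<partial>\<mm>) + ennreal \<epsilon>"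
proof -
  obtain L where L: "L \<ge> 0" "\<And>x y. x \<in> M \<Longrightarrow> y \<in> M \<Longrightarrow> \<bar>f x - f y\<bar> \<le> L * d x y"
    using f LIP_iff by blast
  have lip_le: "lip_a f x \<le> L" for x
    by (rule order_trans[OF lip_a_le_Lip_mball[OF f zero_less_one] Lip_le]) (use L in auto)
  have lip_ge: "- L \<le> - lip_a f x" for x using lip_le by simp
  have conv_ge: "- L \<le> - lip_a f y + real n * d x y" for n x y
  proof -
    have "0 \<le> real n * d x y" by simp
    then show ?thesis using lip_le[of y] by linarith
  qed
  define V where "V n x = (INF y\<in>M. - lip_a f y + real n * d x y)" for n x
  \<comment> \<open>The summand \<open>2 / (n + 1)\<close> provides the margin, with \<open>e = 1 / (n + 1)\<close>.\<close>
  define \<theta> where "\<theta> n x = 2 / real (Suc n) - V n x" for n x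
  have V_le: "V n x \<le> - lip_a f x" if "x \<in> M" for n x
  proof -
    have "V n x \<le> - lip_a f x + real n * d x x"
      unfolding V_def
      by (rule cINF_lower) (use that conv_ge in \<open>auto intro!: bdd_belowI[of _ "- L"] simp del: add_uminus_conv_diff\<close>)
    with that show ?thesis by simp
  qed
  have V_ge: "- L \<le> V n x" for n x
    unfolding V_def by (rule cINF_greatest[OF \<open>M \<noteq> {}\<close>]) (rule conv_ge)
  have \<theta>_le: "\<theta> n x \<le> L + 2" for n x
  proof -
    have "2 / real (Suc n) \<le> 2" by (simp add: divide_le_eq)
    then show ?thesis using V_ge[of n x] by (simp add: \<theta>_def)
  qed
  have \<theta>_ge: "lip_a f x + 2 * (1 / real (Suc n)) \<le> \<theta> n x" if "x \<in> M" for n x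
    using V_le[OF that, of n] by (simp add: \<theta>_def)
  have \<theta>_nonneg: "0 \<le> \<theta> n x" if "x \<in> M" for n x
    using \<theta>_ge[OF that, of n] lip_a_nonneg[OF f, of x] by (smt (verit) zero_le_divide_1_iff of_nat_0_le_iff)
  have \<theta>_cont: "continuous_map mtopology euclideanreal (\<theta> n)" for n
  proof (rule Lipschitz_imp_continuous_map)
    fix x y assume "x \<in> M" "y \<in> M"
    then show "\<bar>\<theta> n x - \<theta> n y\<bar> \<le> real n * d x y"
      using inf_convolution_Lipschitz[where a = "\<lambda>y. - lip_a f y" and c = "real n" and b = "- L",
          OF \<open>M \<noteq> {}\<close> order_refl of_nat_0_le_iff lip_ge, of x y]
      unfolding \<theta>_def V_def by (simp add: abs_minus_commute)
  qed
  have \<theta>_lim: "(\<lambda>n. \<theta> n x) \<longlonglongrightarrow> lip_a f x" if x: "x \<in> M" for x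
  proof (rule tendsto_sandwich)
    show "eventually (\<lambda>n. lip_a f x \<le> \<theta> n x) sequentially"
    proof (rule always_eventually, rule allI)
      fix n
      have "0 \<le> 2 * (1 / real (Suc n))" by simp
      with \<theta>_ge[OF x, of n] show "lip_a f x \<le> \<theta> n x" by linarith
    qed
    have "(\<lambda>n. - V n x) \<longlonglongrightarrow> lip_a f x"
    proof (rule order_tendstoI)
      fix c assume "c < lip_a f x"
      then show "eventually (\<lambda>n. c < - V n x) sequentially"
        using V_le[OF x] by (intro always_eventually allI) (smt (verit))
    next
      fix c assume "lip_a f x < c"
      define c' where "c' = (lip_a f x + c) / 2"
      have c': "lip_a f x < c'" "c' < c" using \<open>lip_a f x < c\<close> by (auto simp: c'_def)
      obtain r where r: "r > 0" "\<And>y. y \<in> mball x r \<Longrightarrow> lip_a f y < c'"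
        using lip_a_less_near[OF f c'(1)] by blast
      obtain N :: nat where N: "L / r < real N" using reals_Archimedean2 by blast
      have "- V n x < c" if "n \<ge> N" for n
      proof -
        have "- c' \<le> V n x"
          unfolding V_def
        proof (rule cINF_greatest[OF \<open>M \<noteq> {}\<close>])
          fix y assume y: "y \<in> M"
          show "- c' \<le> - lip_a f y + real n * d x y"
          proof (cases "d x y < r")
            case True
            then have "lip_a f y < c'" using r(2) x y by simp
            moreover have "0 \<le> real n * d x y" by simp
            ultimately show ?thesis by linarith
          next
            case False
            have "L \<le> real N * r" using N r(1) by (simp add: pos_divide_less_eq)
            also have "\<dots> \<le> real n * d x y"
              using that False r(1) by (intro mult_mono) auto
            finally show ?thesis
              using lip_le[of y] c'(1) lip_a_nonneg[OF f, of x] by linarith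
          qed
        qed
        then show ?thesis using c'(2) by linarith
      qed
      then show "eventually (\<lambda>n. - V n x < c) sequentially"
        unfolding eventually_sequentially by blast
    qed
    moreover have "(\<lambda>n. 2 / real (Suc n)) \<longlonglongrightarrow> 0"
      using LIMSEQ_Suc[OF tendsto_divide_0[OF tendsto_const filterlim_real_sequentially[THEN filterlim_at_top_imp_at_infinity], of 2]]
      by simp
    ultimately have "(\<lambda>n. 2 / real (Suc n) + - V n x) \<longlonglongrightarrow> 0 + lip_a f x"
      by (intro tendsto_add)
    then show "(\<lambda>n. \<theta> n x) \<longlonglongrightarrow> lip_a f x"
      by (simp add: \<theta>_def)
  qed simp_all
  define I where "I = (\<integral>\<^sup>+x. ennreal (lip_a f x powr p) * indicator S x \<partial>\<mm>)"
  have [measurable]: "lip_a f \<in> borel_measurable \<mm>" "\<And>n. \<theta> n \<in> borel_measurable \<mm>" "S \<in> sets \<mm>"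
    using lip_a_measurable[OF f] continuous_map_measurable[OF \<theta>_cont] S by auto
  have "(\<lambda>n. \<integral>\<^sup>+x. ennreal (\<theta> n x powr p) * indicator S x \<partial>\<mm>) \<longlonglongrightarrow> I"
    unfolding I_def
  proof (rule nn_integral_dominated_convergence)
    show "AE x in \<mm>. ennreal (\<theta> n x powr p) * indicator S x \<le> ennreal ((L + 2) powr p) * indicator S x" for n
    proof (rule AE_I2)
      fix x assume "x \<in> space \<mm>"
      then show "ennreal (\<theta> n x powr p) * indicator S x \<le> ennreal ((L + 2) powr p) * indicator S x"
        using \<theta>_le[of n x] \<theta>_nonneg[of x n] \<open>p > 0\<close> space_eq
        by (intro mult_right_mono ennreal_leI powr_mono2) auto
    qed
    show "(\<integral>\<^sup>+x. ennreal ((L + 2) powr p) * indicator S x \<partial>\<mm>) < \<infinity>"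
      using S by (simp add: nn_integral_cmult_indicator ennreal_mult_less_top)
    show "AE x in \<mm>. (\<lambda>n. ennreal (\<theta> n x powr p) * indicator S x)
        \<longlonglongrightarrow> ennreal (lip_a f x powr p) * indicator S x"
    proof (rule AE_I2)
      fix x assume "x \<in> space \<mm>"
      then have x: "x \<in> M" by (simp add: space_eq)
      have "(\<lambda>n. \<theta> n x powr p) \<longlonglongrightarrow> lip_a f x powr p"
        using \<theta>_lim[OF x] \<theta>_nonneg[OF x] \<open>p > 0\<close>
        by (intro tendsto_powr2[OF _ tendsto_const]) auto
      then show "(\<lambda>n. ennreal (\<theta> n x powr p) * indicator S x)
          \<longlonglongrightarrow> ennreal (lip_a f x powr p) * indicator S x"
        by (cases "x \<in> S") (auto intro: tendsto_ennrealI)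
    qed
  qed measurable
  moreover have "I < \<infinity>"
  proof -
    have "I \<le> (\<integral>\<^sup>+x. ennreal (L powr p) * indicator S x \<partial>\<mm>)"
      unfolding I_def using lip_le lip_a_nonneg[OF f] \<open>p > 0\<close>
      by (intro nn_integral_mono mult_right_mono ennreal_leI powr_mono2) auto
    also have "\<dots> < \<infinity>"
      using S by (simp add: nn_integral_cmult_indicator ennreal_mult_less_top)
    finally show ?thesis .
  qed
  then have "I < I + ennreal \<epsilon>"
    using ennreal_add_left_cancel_less[of I 0 "ennreal \<epsilon>"] \<open>\<epsilon> > 0\<close> by simp
  ultimately have "eventually (\<lambda>n. (\<integral>\<^sup>+x. ennreal (\<theta> n x powr p) * indicator S x \<partial>\<mm>) < I + ennreal \<epsilon>) sequentially"
    by (rule order_tendstoD(2))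
  then obtain n where "(\<integral>\<^sup>+x. ennreal (\<theta> n x powr p) * indicator S x \<partial>\<mm>) < I + ennreal \<epsilon>"
    unfolding eventually_sequentially by blast
  then show thesis
    using that[of "1 / real (Suc n)" "\<theta> n" "L + 2"] \<theta>_cont \<theta>_le \<theta>_ge unfolding I_def by auto
qed

text \<open>Balls around the points of a dense sequence cover the space, and the measure of \<open>S\<close> is
  continuous from above. This is the covering step in the proof that finite measures on complete
  separable spaces are tight.\<close>

lemma finite_balls_almost_cover:
  assumes "M \<noteq> {}" and S: "S \<in> sets \<mm>" "emeasure \<mm> S < \<infinity>" and "t > 0" "\<eta> > 0"
  obtains K where "finite K" "K \<noteq> {}" "K \<subseteq> M" "emeasure \<mm> (S - (\<Union>y\<in>K. mball y t)) \<le> ennreal \<eta>"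
proof -
  obtain D where D: "countable D" "D \<subseteq> M" "mtopology closure_of D = M"
    using separable unfolding separable_def by blast
  have "D \<noteq> {}" using D(3) \<open>M \<noteq> {}\<close> by auto
  define x where "x = from_nat_into D"
  have range_x: "range x = D"
    unfolding x_def using \<open>D \<noteq> {}\<close> D(1) by (rule range_from_nat_into)
  define A where "A n = S - (\<Union>y\<in>x ` {..n}. mball y t)" for n
  have "A n \<in> sets \<mm>" for n
    unfolding A_def using S openin_measurable[OF openin_mball] by (intro sets.Diff sets.finite_UN) auto
  moreover have "decseq A"
    unfolding decseq_def A_def by (auto intro: order_trans)
  moreover have "emeasure \<mm> (A n) \<noteq> \<infinity>" for n
  proof -
    have "emeasure \<mm> (A n) \<le> emeasure \<mm> S"
      using S(1) by (intro emeasure_mono) (auto simp: A_def)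
    then show ?thesis using S(2) by (auto simp: top_unique)
  qed
  ultimately have "(\<lambda>n. emeasure \<mm> (A n)) \<longlonglongrightarrow> emeasure \<mm> (\<Inter>n. A n)"
    by (intro Lim_emeasure_decseq) auto
  moreover have "(\<Inter>n. A n) = {}"
  proof -
    have "\<exists>n. y \<in> mball (x n) t" if "y \<in> M" for y
    proof -
      have "y \<in> mtopology closure_of D" using that D(3) by simp
      then obtain z where "z \<in> D" "z \<in> mball y t"
        using \<open>t > 0\<close> unfolding metric_closure_of by blast
      then show ?thesis
        using range_x that by (metis commute in_mball rangeE)
    qed
    moreover have "S \<subseteq> M" using S(1) sets.sets_into_space space_eq by blast
    ultimately show ?thesis unfolding A_def by fastforce
  qed
  ultimately have "eventually (\<lambda>n. emeasure \<mm> (A n) < ennreal \<eta>) sequentially"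
    using \<open>\<eta> > 0\<close> by (intro order_tendstoD(2)) auto
  then obtain n where "emeasure \<mm> (A n) < ennreal \<eta>"
    unfolding eventually_sequentially by blast
  then show thesis
    using that[of "x ` {..n}"] range_x D(2) unfolding A_def by (auto simp: order_less_imp_le)
qed

end

primrec running_max :: "(nat \<Rightarrow> 'a \<Rightarrow> real) \<Rightarrow> nat \<Rightarrow> 'a \<Rightarrow> real" where
  "running_max a 0 x = a 0 x"
| "running_max a (Suc n) x = max (running_max a n x) (a (Suc n) x)"

lemma running_max_ge: "j \<le> i \<Longrightarrow> a j x \<le> running_max a i x"
  by (induction i) (auto simp: le_Suc_eq)

lemma running_max_attained: "\<exists>j\<le>i. running_max a i x = a j x"
proof (induction i)
  case (Suc i)
  then show ?case by (auto simp: max_def intro: le_SucI)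
qed simp

lemma running_max_continuous:
  "(\<And>j. continuous_map X euclideanreal (a j)) \<Longrightarrow> continuous_map X euclideanreal (running_max a i)"
proof (induction i)
  case 0
  have "running_max a 0 = a 0" by auto
  then show ?case using 0 by metis
next
  case (Suc i)
  have "running_max a (Suc i) = (\<lambda>x. max (running_max a i x) (a (Suc i) x))" by auto
  then show ?case using Suc by (auto intro!: continuous_map_real_max)
qed

text \<open>Finitely many balls of radius \<open>1 / (j + 1)\<close> cover \<open>S\<close> up to a set \<open>A j\<close> of tiny measure. A
  continuous function that is \<open>0\<close> on these balls and \<open>j\<close> away from the balls of twice the radius is
  added to \<open>\<theta>\<close> (the maximum of these functions over \<open>j \<le> i\<close>, to be precise). Inside \<open>S\<close> the
  \<open>j\<close>-th function vanishes off \<open>A j\<close>, and where it attains the maximum the weight is at most \<open>C + j\<close>; as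
  the measure of \<open>A j\<close> is made small depending on \<open>C + j\<close>, the total energy added is at most \<open>\<epsilon>\<close>.\<close>

lemma (in metric_measure_space) coercive_weights:
  assumes "M \<noteq> {}" and S: "S \<in> sets \<mm>" "emeasure \<mm> S < \<infinity>" and "p > 0" "\<epsilon> > 0"
    and \<theta>: "continuous_map mtopology euclideanreal \<theta>" "\<And>x. x \<in> M \<Longrightarrow> 0 \<le> \<theta> x"
      "\<And>x. x \<in> M \<Longrightarrow> \<theta> x \<le> C"
  obtains \<rho> :: "nat \<Rightarrow> 'a \<Rightarrow> real" where
    "\<And>i. continuous_map mtopology euclideanreal (\<rho> i)"
    "\<And>i x. x \<in> M \<Longrightarrow> \<theta> x \<le> \<rho> i x" "\<And>i x. x \<in> M \<Longrightarrow> \<rho> i x \<le> C + real i"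
    "\<And>i. (\<integral>\<^sup>+x. ennreal (\<rho> i x powr p) * indicator S x \<partial>\<mm>)
      \<le> (\<integral>\<^sup>+x. ennreal (\<theta> x powr p) * indicator S x \<partial>\<mm>) + ennreal \<epsilon>"
    "\<And>j. \<exists>K. finite K \<and> K \<subseteq> M \<and>
      (\<forall>i\<ge>j. \<forall>x\<in>M. \<rho> i x < real j \<longrightarrow> (\<exists>y\<in>K. d y x < 2 / real (Suc j)))"
proof -
  obtain x0 where "x0 \<in> M" using \<open>M \<noteq> {}\<close> by blast
  then have "0 \<le> C" using \<theta>(2,3) order_trans by blast
  \<comment> \<open>The added \<open>1\<close> only guards against division by zero.\<close>
  define \<eta> where "\<eta> j = \<epsilon> * (1 / 2) ^ Suc j / ((C + real j) powr p + 1)" for j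
  have \<eta>: "\<eta> j > 0" for j
    unfolding \<eta>_def using \<open>\<epsilon> > 0\<close> by (intro divide_pos_pos mult_pos_pos add_nonneg_pos) auto
  have "\<exists>K. finite K \<and> K \<noteq> {} \<and> K \<subseteq> M \<and>
      emeasure \<mm> (S - (\<Union>y\<in>K. mball y (1 / real (Suc j)))) \<le> ennreal (\<eta> j)" for j
    using finite_balls_almost_cover[OF \<open>M \<noteq> {}\<close> S _ \<eta>[of j], of "1 / real (Suc j)"]
    by (metis zero_less_divide_1_iff of_nat_0_less_iff zero_less_Suc)
  then obtain K where K: "\<And>j. finite (K j)" "\<And>j. K j \<noteq> {}" "\<And>j. K j \<subseteq> M"
      "\<And>j. emeasure \<mm> (S - (\<Union>y\<in>K j. mball y (1 / real (Suc j)))) \<le> ennreal (\<eta> j)"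
    by metis
  define A where "A j = S - (\<Union>y\<in>K j. mball y (1 / real (Suc j)))" for j
  have A_sets: "A j \<in> sets \<mm>" for j
    unfolding A_def using S K(1) openin_measurable[OF openin_mball] by (intro sets.Diff sets.finite_UN) auto
  define D where "D j x = (INF y\<in>K j. 0 + 1 * d x y)" for j x
  define \<psi> where "\<psi> j x = min 1 (max 0 (real (Suc j) * D j x - 1))" for j x
  have D_cont: "continuous_map mtopology euclideanreal (D j)" for j
  proof (rule Lipschitz_imp_continuous_map)
    fix x y assume "x \<in> M" "y \<in> M"
    then show "\<bar>D j x - D j y\<bar> \<le> 1 * d x y"
      unfolding D_def by (intro inf_convolution_Lipschitz[where b = 0] K) auto
  qed
  have \<psi>_cont: "continuous_map mtopology euclideanreal (\<lambda>x. real j * \<psi> j x)" for j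
    unfolding \<psi>_def by (intro continuous_intros D_cont) auto
  have \<psi>_bounds: "0 \<le> \<psi> j x" "\<psi> j x \<le> 1" for j x by (auto simp: \<psi>_def)
  have \<psi>_less_1: "\<exists>y\<in>K j. d y x < 2 / real (Suc j)" if "x \<in> M" "\<psi> j x < 1" for j x
  proof -
    have "real (Suc j) * D j x - 1 < 1"
      using that(2) by (auto simp: \<psi>_def min_def max_def split: if_splits)
    then have "D j x < 2 / real (Suc j)"
      by (simp add: pos_less_divide_eq mult.commute del: of_nat_Suc)
    then obtain y where "y \<in> K j" "d x y < 2 / real (Suc j)"
      unfolding D_def using cInf_lessD[of "(\<lambda>y. 0 + 1 * d x y) ` K j"] K(2)[of j] by auto
    then show ?thesis using commute[of x y] by auto
  qed
  have \<psi>_pos: "x \<in> A j" if "x \<in> S" "0 < \<psi> j x" for j x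
  proof -
    have "1 < real (Suc j) * D j x"
      using that(2) by (auto simp: \<psi>_def min_def max_def split: if_splits)
    then have "1 / real (Suc j) < D j x"
      by (simp add: pos_divide_less_eq mult.commute del: of_nat_Suc)
    moreover have "D j x \<le> d y x" if "y \<in> K j" for y
    proof -
      have "D j x \<le> 0 + 1 * d x y"
        unfolding D_def by (rule cINF_lower) (use that K(1) in auto)
      then show ?thesis using commute[of x y] by simp
    qed
    ultimately have "x \<notin> mball y (1 / real (Suc j))" if "y \<in> K j" for y
      using that by fastforce
    with that(1) show ?thesis unfolding A_def by blast
  qed
  define \<Psi> where "\<Psi> = running_max (\<lambda>j x. real j * \<psi> j x)"
  define \<rho> where "\<rho> i x = \<theta> x + \<Psi> i x" for i x
  have \<Psi>_ge: "real j * \<psi> j x \<le> \<Psi> i x" if "j \<le> i" for i j x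
    unfolding \<Psi>_def using running_max_ge[OF that, of "\<lambda>j x. real j * \<psi> j x"] .
  have \<Psi>_attained: "\<exists>j\<le>i. \<Psi> i x = real j * \<psi> j x" for i x
    unfolding \<Psi>_def by (rule running_max_attained)
  have \<Psi>_nonneg: "0 \<le> \<Psi> i x" for i x
    using \<Psi>_ge[of 0 i x] by simp
  have \<Psi>_le: "real j * \<psi> j x \<le> real j" for j x
    using mult_left_mono[OF \<psi>_bounds(2), of "real j" j x] by simp
  have \<rho>_cont: "continuous_map mtopology euclideanreal (\<rho> i)" for i
    unfolding \<rho>_def \<Psi>_def
    by (intro continuous_map_add \<theta> running_max_continuous \<psi>_cont)
  have energy: "(\<integral>\<^sup>+x. ennreal (\<rho> i x powr p) * indicator S x \<partial>\<mm>)
      \<le> (\<integral>\<^sup>+x. ennreal (\<theta> x powr p) * indicator S x \<partial>\<mm>) + ennreal \<epsilon>" for i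
  proof -
    have [measurable]: "\<theta> \<in> borel_measurable \<mm>" "S \<in> sets \<mm>" "\<And>j. A j \<in> sets \<mm>"
      using continuous_map_measurable[OF \<theta>(1)] S A_sets by auto
    have "(\<integral>\<^sup>+x. ennreal (\<rho> i x powr p) * indicator S x \<partial>\<mm>)
        \<le> (\<integral>\<^sup>+x. ennreal (\<theta> x powr p) * indicator S x
            + (\<Sum>j\<le>i. ennreal ((C + real j) powr p) * indicator (A j) x) \<partial>\<mm>)"
    proof (rule nn_integral_mono)
      fix x assume "x \<in> space \<mm>"
      then have x: "x \<in> M" by (simp add: space_eq)
      obtain j where j: "j \<le> i" "\<Psi> i x = real j * \<psi> j x" using \<Psi>_attained by blast
      show "ennreal (\<rho> i x powr p) * indicator S x \<le> ennreal (\<theta> x powr p) * indicator S x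
          + (\<Sum>j\<le>i. ennreal ((C + real j) powr p) * indicator (A j) x)"
      proof (cases "x \<in> S \<and> 0 < \<psi> j x")
        case True
        then have "x \<in> A j" using \<psi>_pos by blast
        have "\<rho> i x \<le> C + real j"
          using \<theta>(3)[OF x] j(2) \<Psi>_le[of j x] by (simp add: \<rho>_def)
        moreover have "0 \<le> \<rho> i x" using \<theta>(2)[OF x] \<Psi>_nonneg by (simp add: \<rho>_def)
        ultimately have "ennreal (\<rho> i x powr p) \<le> ennreal ((C + real j) powr p) * indicator (A j) x"
          using \<open>x \<in> A j\<close> \<open>p > 0\<close> by (auto intro!: ennreal_leI powr_mono2)
        also have "\<dots> \<le> (\<Sum>j\<le>i. ennreal ((C + real j) powr p) * indicator (A j) x)"
          using j(1) by (intro member_le_sum[where f = "\<lambda>j. ennreal ((C + real j) powr p) * indicator (A j) x"]) auto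
        finally show ?thesis using True by (auto intro: add_increasing)
      next
        case False
        then have "x \<in> S \<Longrightarrow> \<rho> i x = \<theta> x"
          using j(2) \<psi>_bounds(1)[of j x] by (auto simp: \<rho>_def)
        then show ?thesis by (cases "x \<in> S") auto
      qed
    qed
    also have "\<dots> = (\<integral>\<^sup>+x. ennreal (\<theta> x powr p) * indicator S x \<partial>\<mm>)
        + (\<Sum>j\<le>i. ennreal ((C + real j) powr p) * emeasure \<mm> (A j))"
      by (subst nn_integral_add, measurable, subst nn_integral_sum, measurable)
         (simp add: nn_integral_cmult_indicator)
    also have "(\<Sum>j\<le>i. ennreal ((C + real j) powr p) * emeasure \<mm> (A j)) \<le> (\<Sum>j\<le>i. ennreal (\<epsilon> * (1 / 2) ^ Suc j))"
    proof (rule sum_mono)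
      fix j
      have "ennreal ((C + real j) powr p) * emeasure \<mm> (A j) \<le> ennreal ((C + real j) powr p) * ennreal (\<eta> j)"
        using K(4)[of j] unfolding A_def by (rule mult_left_mono) simp
      also have "\<dots> = ennreal ((C + real j) powr p * \<eta> j)"
        using \<eta>[of j] by (simp add: ennreal_mult)
      also have "(C + real j) powr p * \<eta> j \<le> \<epsilon> * (1 / 2) ^ Suc j"
      proof -
        have "(C + real j) powr p * \<eta> j \<le> ((C + real j) powr p + 1) * \<eta> j"
          using \<eta>[of j] by (intro mult_right_mono) auto
        also have "\<dots> = \<epsilon> * (1 / 2) ^ Suc j"
          using add_nonneg_pos[OF powr_ge_zero zero_less_one, of "C + real j" p]
          unfolding \<eta>_def by (metis nonzero_mult_div_cancel_left order_less_irrefl times_divide_eq_right)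
        finally show ?thesis .
      qed
      finally show "ennreal ((C + real j) powr p) * emeasure \<mm> (A j) \<le> ennreal (\<epsilon> * (1 / 2) ^ Suc j)"
        by (simp add: ennreal_leI)
    qed
    also have "\<dots> = ennreal (\<Sum>j\<le>i. \<epsilon> * (1 / 2) ^ Suc j)"
      using \<open>\<epsilon> > 0\<close> by (intro sum_ennreal) auto
    also have "(\<Sum>j\<le>i. \<epsilon> * (1 / 2) ^ Suc j) \<le> \<epsilon>"
    proof -
      have "(\<Sum>j\<le>i. \<epsilon> * (1 / 2) ^ Suc j) = \<epsilon> * (1 - (1 / 2) ^ Suc i)"
        by (induction i) (auto simp: algebra_simps)
      also have "\<dots> \<le> \<epsilon> * 1"
        using \<open>\<epsilon> > 0\<close> by (intro mult_left_mono) auto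
      finally show ?thesis by simp
    qed
    finally show ?thesis by (simp add: add_left_mono ennreal_leI)
  qed
  show thesis
  proof (rule that[OF \<rho>_cont _ _ energy])
    show "\<theta> x \<le> \<rho> i x" for i x using \<Psi>_nonneg by (simp add: \<rho>_def)
    show "\<rho> i x \<le> C + real i" if "x \<in> M" for i x
    proof -
      obtain j where "j \<le> i" "\<Psi> i x = real j * \<psi> j x" using \<Psi>_attained by blast
      then have "\<Psi> i x \<le> real i" using \<Psi>_le[of j x] by simp
      then show ?thesis using \<theta>(3)[OF that] by (simp add: \<rho>_def)
    qed
    show "\<exists>K. finite K \<and> K \<subseteq> M \<and>
      (\<forall>i\<ge>j. \<forall>x\<in>M. \<rho> i x < real j \<longrightarrow> (\<exists>y\<in>K. d y x < 2 / real (Suc j)))" for j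
    proof (intro exI[of _ "K j"] conjI K allI ballI impI)
      fix i x assume "j \<le> i" "x \<in> M" "\<rho> i x < real j"
      then have "real j * \<psi> j x < real j * 1"
        using \<Psi>_ge[of j i x] \<theta>(2)[of x] by (simp add: \<rho>_def)
      then have "\<psi> j x < 1" by (rule mult_left_less_imp_less) simp
      then show "\<exists>y\<in>K j. d y x < 2 / real (Suc j)" using \<psi>_less_1 \<open>x \<in> M\<close> by blast
    qed
  qed
qed

section \<open>The approximation theorem\<close>

lemma (in approximating_distances) mbounded_di:
  assumes "mbounded S"
  shows "Metric_space.mbounded M (di i) S"
proof -
  interpret Di: Metric_space M "di i" by (rule di_metric)
  obtain B where "S \<subseteq> M" "\<And>x y. x \<in> S \<Longrightarrow> y \<in> S \<Longrightarrow> d x y \<le> B"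
    using assms unfolding mbounded_alt by blast
  then show ?thesis
    unfolding Di.mbounded_alt using di_le by (meson order_trans subsetD)
qed

lemma (in Metric_space) boundedly_supported_LIP_bounded:
  assumes "f \<in> LIP" "boundedly_supported f"
  obtains F where "F \<ge> 0" "\<And>x. x \<in> M \<Longrightarrow> \<bar>f x\<bar> \<le> F"
proof -
  define S where "S = mtopology closure_of {x \<in> M. f x \<noteq> 0}"
  obtain L where L: "L \<ge> 0" "\<And>x y. x \<in> M \<Longrightarrow> y \<in> M \<Longrightarrow> \<bar>f x - f y\<bar> \<le> L * d x y"
    using assms(1) LIP_iff by blast
  obtain B where B: "S \<subseteq> M" "\<And>x y. x \<in> S \<Longrightarrow> y \<in> S \<Longrightarrow> d x y \<le> B"
    using assms(2) unfolding boundedly_supported_def S_def[symmetric] mbounded_alt by blast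
  have supp: "x \<in> S" if "x \<in> M" "f x \<noteq> 0" for x
    using that closure_of_subset[of "{x \<in> M. f x \<noteq> 0}" mtopology] by (auto simp: S_def)
  show thesis
  proof (cases "\<exists>x0\<in>M. f x0 \<noteq> 0")
    case False
    then show ?thesis using that[of 0] by force
  next
    case True
    then obtain x0 where x0: "x0 \<in> M" "f x0 \<noteq> 0" by blast
    have "\<bar>f x\<bar> \<le> \<bar>f x0\<bar> + L * \<bar>B\<bar>" if "x \<in> M" for x
    proof (cases "f x = 0")
      case False
      have "\<bar>f x - f x0\<bar> \<le> L * d x x0" using L that x0 by blast
      also have "\<dots> \<le> L * \<bar>B\<bar>"
        using B(2)[of x x0] supp that False x0 L(1) by (intro mult_left_mono) force+
      finally show ?thesis by linarith
    qed (use L in simp)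
    then show ?thesis
      using that[of "\<bar>f x0\<bar> + L * \<bar>B\<bar>"] L(1) by simp
  qed
qed

text \<open>On a small ball around \<open>x\<close> the Lipschitz constant of \<open>f\<close> is below \<open>lip_a f x + e\<close>, and \<open>\<theta>\<close> is
  still above this value.\<close>

lemma slope_weight_local:
  assumes "Metric_space M d" "f \<in> Metric_space.LIP M d" "e > 0"
    and \<theta>: "continuous_map (Metric_space.mtopology M d) euclideanreal \<theta>"
      "\<And>x. x \<in> M \<Longrightarrow> Metric_space.lip_a M d f x + 2 * e \<le> \<theta> x"
    and \<rho>: "\<And>i x. x \<in> M \<Longrightarrow> \<theta> x \<le> \<rho> i x" and x: "x \<in> M"
  shows "\<exists>l\<ge>e. \<exists>r>0. \<forall>y\<in>Metric_space.mball M d x r.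
    \<bar>f x - f y\<bar> \<le> l * d x y \<and> (\<forall>i::nat. l \<le> \<rho> i y)"
proof -
  interpret Metric_space M d by fact
  define l where "l = lip_a f x + e"
  obtain r where r: "r > 0" "Lip f (mball x r) < l"
    using lip_a_lessD[of f x l] \<open>e > 0\<close> by (auto simp: l_def)
  obtain s where s: "s > 0" "\<And>y. y \<in> mball x s \<Longrightarrow> \<bar>\<theta> y - \<theta> x\<bar> < e"
    using \<theta>(1) x \<open>e > 0\<close> unfolding continuous_map_real_iff by blast
  have "\<bar>f x - f y\<bar> \<le> l * d x y \<and> (\<forall>i. l \<le> \<rho> i y)" if y: "y \<in> mball x (min r s)" for y
  proof (intro conjI allI)
    have "\<bar>f x - f y\<bar> \<le> Lip f (mball x r) * d x y"
      using y r(1) x by (intro le_Lip_mult_dist assms mball_subset_mspace) auto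
    also have "\<dots> \<le> l * d x y"
      using r(2) by (intro mult_right_mono) auto
    finally show "\<bar>f x - f y\<bar> \<le> l * d x y" .
    fix i
    show "l \<le> \<rho> i y"
      using s(2)[of y] \<theta>(2)[OF x] \<rho>[of y i] y unfolding l_def by auto
  qed
  moreover have "e \<le> l" using lip_a_nonneg[OF assms(2)] by (simp add: l_def)
  ultimately show ?thesis
    using r(1) s(1) by (intro exI[of _ l] conjI exI[of _ "min r s"]) auto
qed

theorem proposition3p3:
  fixes M :: "'a set" and d :: "'a \<Rightarrow> 'a \<Rightarrow> real" and \<mm> :: "'a measure"
    and di :: "nat \<Rightarrow> 'a \<Rightarrow> 'a \<Rightarrow> real" and p :: real and f :: "'a \<Rightarrow> real" and \<epsilon> :: real
  assumes "metric_measure_space M d \<mm>"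
    and "\<And>i. Metric_space M (di i)"
    and "\<And>i x y. x \<in> M \<Longrightarrow> y \<in> M \<Longrightarrow> di i x y \<le> di (Suc i) x y"
    and "\<And>x y. x \<in> M \<Longrightarrow> y \<in> M \<Longrightarrow> (\<lambda>i. di i x y) \<longlonglongrightarrow> d x y"
    and "\<And>i. Metric_space.mtopology M (di i) = Metric_space.mtopology M d"
    and "1 < p"
    and "f \<in> Metric_space.LIP M d"
    and "Metric_space.boundedly_supported M d f"
    and "\<epsilon> > 0"
  shows "\<exists>i g. g \<in> Metric_space.LIP M (di i) \<and> Metric_space.boundedly_supported M (di i) g \<and>
    (\<integral>\<^sup>+ x. ennreal (\<bar>g x - f x\<bar> powr p) \<partial>\<mm>) \<le> ennreal \<epsilon> \<and>
    (\<integral>\<^sup>+ x. ennreal (Metric_space.lip_a M (di i) g x powr p) \<partial>\<mm>)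
      \<le> (\<integral>\<^sup>+ x. ennreal (Metric_space.lip_a M d f x powr p) \<partial>\<mm>) + ennreal \<epsilon>"
proof -
  interpret metric_measure_space M d \<mm> by fact
  interpret approximating_distances M d di
    by (intro approximating_distances.intro approximating_distances_axioms.intro
        Metric_space_axioms assms(2-5))
  show ?thesis
  proof (cases "M = {}")
    case True
    \<comment> \<open>The dense sequences and the infima over \<open>M\<close> used otherwise require a point.\<close>
    interpret Di: Metric_space M "di 0" by (rule di_metric)
    have "space \<mm> = {}" using space_eq True by simp
    then have "(\<integral>\<^sup>+ x. h x \<partial>\<mm>) = 0" for h :: "'a \<Rightarrow> ennreal"
      by (rule nn_integral_empty)
    moreover have "f \<in> Di.LIP" unfolding Di.LIP_iff using True by auto
    moreover have "Di.boundedly_supported f"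
      unfolding Di.boundedly_supported_def using True Di.mbounded_empty by simp
    ultimately show ?thesis by (intro exI[of _ 0] exI[of _ f]) simp
  next
    case False
    define S where "S = mtopology closure_of {x \<in> M. f x \<noteq> 0}"
    have S_closed: "closedin mtopology S" unfolding S_def by simp
    have S_sets: "S \<in> sets \<mm>" by (rule closedin_measurable[OF S_closed])
    have S_bounded: "mbounded S"
      using assms(8) unfolding boundedly_supported_def S_def .
    have S_finite: "emeasure \<mm> S < \<infinity>" by (rule boundedly_finite[OF S_sets S_bounded])
    have off_S: "f x = 0" if "x \<in> M" "x \<notin> S" for x
      using that closure_of_subset[of "{x \<in> M. f x \<noteq> 0}" mtopology] by (auto simp: S_def)
    obtain F where F: "F \<ge> 0" "\<And>x. x \<in> M \<Longrightarrow> \<bar>f x\<bar> \<le> F"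
      using boundedly_supported_LIP_bounded[OF assms(7,8)] by blast
    have "p > 0" "\<epsilon> / 2 > 0" using assms by auto
    obtain \<theta> e C where \<theta>: "e > 0" "continuous_map mtopology euclideanreal \<theta>"
      "\<And>x. x \<in> M \<Longrightarrow> \<theta> x \<le> C" "\<And>x. x \<in> M \<Longrightarrow> lip_a f x + 2 * e \<le> \<theta> x"
      "(\<integral>\<^sup>+x. ennreal (\<theta> x powr p) * indicator S x \<partial>\<mm>)
        \<le> (\<integral>\<^sup>+x. ennreal (lip_a f x powr p) * indicator S x \<partial>\<mm>) + ennreal (\<epsilon> / 2)"
      by (rule slope_continuous_majorant[OF assms(7) False S_sets S_finite \<open>p > 0\<close> \<open>\<epsilon> / 2 > 0\<close>]) (rule that)
    have \<theta>_nonneg: "0 \<le> \<theta> x" if "x \<in> M" for x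
      using \<theta>(4)[OF that] \<theta>(1) lip_a_nonneg[OF assms(7), of x] by linarith
    obtain \<rho> where \<rho>: "\<And>i. continuous_map mtopology euclideanreal (\<rho> i)"
      "\<And>i x. x \<in> M \<Longrightarrow> \<theta> x \<le> \<rho> i x" "\<And>i x. x \<in> M \<Longrightarrow> \<rho> i x \<le> C + real i"
      "\<And>i. (\<integral>\<^sup>+x. ennreal (\<rho> i x powr p) * indicator S x \<partial>\<mm>)
        \<le> (\<integral>\<^sup>+x. ennreal (\<theta> x powr p) * indicator S x \<partial>\<mm>) + ennreal (\<epsilon> / 2)"
      "\<And>j. \<exists>K. finite K \<and> K \<subseteq> M \<and>
        (\<forall>i\<ge>j. \<forall>x\<in>M. \<rho> i x < real j \<longrightarrow> (\<exists>y\<in>K. d y x < 2 / real (Suc j)))"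
      by (rule coercive_weights[where C = C, OF False S_sets S_finite \<open>p > 0\<close> \<open>\<epsilon> / 2 > 0\<close> \<theta>(2)])
         (erule \<theta>_nonneg, erule \<theta>(3), rule that)
    have \<rho>_nonneg: "0 \<le> \<rho> i x" if "x \<in> M" for i x
      using \<theta>_nonneg[OF that] \<rho>(2)[OF that, of i] by linarith
    have local: "\<exists>l\<ge>e. \<exists>r>0. \<forall>y\<in>mball x r. \<bar>f x - f y\<bar> \<le> l * d x y \<and> (\<forall>i. l \<le> \<rho> i y)"
      if "x \<in> M" for x
      by (rule slope_weight_local[OF Metric_space_axioms assms(7) \<theta>(1,2,4) \<rho>(2) that])
    interpret W: weighted_approximation M d di f \<rho> F e
      using complete F(2) \<theta>(1) \<rho>_nonneg local \<rho>(5) by unfold_locales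
    interpret W': weighted_approximation M d di "\<lambda>x. - f x" \<rho> F e
      using complete F(2) \<theta>(1) \<rho>_nonneg local \<rho>(5) by unfold_locales (auto simp: abs_minus_commute)
    define g where "g i = Metric_space.chain_median M (di i) (1 / real (Suc i)) (\<rho> i) f" for i
    have g_LIP: "g i \<in> Metric_space.LIP M (di i)" for i
      unfolding g_def
      by (rule Metric_space.chain_median_LIP[where F = F and C = "C + real i"])
         (use di_metric \<rho>_nonneg F(2) \<rho>(3) in auto)
    have g_bound: "\<bar>g i x\<bar> \<le> F" if "x \<in> M" for i x
      unfolding g_def
      by (rule Metric_space.chain_median_bound) (use di_metric \<rho>_nonneg F(2) that in auto)
    have g_0: "g i x = 0" if "x \<in> M" "f x = 0" for i x
      unfolding g_def
      by (rule Metric_space.chain_median_eq_0[where F = F]) (use di_metric \<rho>_nonneg F(2) that in auto)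
    have g_cont: "continuous_map mtopology euclideanreal (g i)" for i
      using Metric_space.LIP_imp_continuous_map[OF di_metric g_LIP] di_topology by simp
    have g_lim: "(\<lambda>i. \<bar>g i x - f x\<bar>) \<longlonglongrightarrow> 0" if x: "x \<in> M" for x
    proof -
      let ?u = "\<lambda>i. f x - W.chain_inf_at i x" and ?v = "\<lambda>i. - f x - W'.chain_inf_at i x"
      have upper: "eventually (\<lambda>i. \<bar>g i x - f x\<bar> \<le> max (?u i) (?v i)) sequentially"
        unfolding g_def
        by (intro always_eventually allI Metric_space.chain_median_diff_le[where F = F])
           (use di_metric \<rho>_nonneg F(2) x in auto)
      have "?u \<longlonglongrightarrow> f x - f x" "?v \<longlonglongrightarrow> - f x - - f x"
        by (intro tendsto_diff tendsto_const W.chain_inf_tendsto[OF x] W'.chain_inf_tendsto[OF x])+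
      from tendsto_max[OF this] have lim: "(\<lambda>i. max (?u i) (?v i)) \<longlonglongrightarrow> 0" by simp
      show ?thesis
        by (rule tendsto_sandwich[OF _ upper tendsto_const lim]) simp
    qed
    have [measurable]: "f \<in> borel_measurable \<mm>" "\<And>i. g i \<in> borel_measurable \<mm>" "S \<in> sets \<mm>"
      using continuous_map_measurable LIP_imp_continuous_map[OF assms(7)] g_cont S_sets by auto
    have "(\<lambda>i. \<integral>\<^sup>+x. ennreal (\<bar>g i x - f x\<bar> powr p) \<partial>\<mm>) \<longlonglongrightarrow> (\<integral>\<^sup>+x. 0 \<partial>\<mm>)"
    proof (rule nn_integral_dominated_convergence)
      show "AE x in \<mm>. ennreal (\<bar>g i x - f x\<bar> powr p) \<le> ennreal ((2 * F) powr p) * indicator S x" for i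
      proof (rule AE_I2)
        fix x assume "x \<in> space \<mm>"
        then have x: "x \<in> M" by (simp add: space_eq)
        show "ennreal (\<bar>g i x - f x\<bar> powr p) \<le> ennreal ((2 * F) powr p) * indicator S x"
        proof (cases "x \<in> S")
          case True
          have "\<bar>g i x - f x\<bar> \<le> 2 * F" using g_bound[OF x, of i] F(2)[OF x] by linarith
          then show ?thesis
            using True \<open>p > 0\<close> by (auto intro!: ennreal_leI powr_mono2)
        next
          case False
          then show ?thesis using off_S[OF x] g_0[OF x] by simp
        qed
      qed
      show "(\<integral>\<^sup>+x. ennreal ((2 * F) powr p) * indicator S x \<partial>\<mm>) < \<infinity>"
        using S_sets S_finite by (simp add: nn_integral_cmult_indicator ennreal_mult_less_top)
      show "AE x in \<mm>. (\<lambda>i. ennreal (\<bar>g i x - f x\<bar> powr p)) \<longlonglongrightarrow> 0"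
      proof (rule AE_I2)
        fix x assume "x \<in> space \<mm>"
        then have x: "x \<in> M" by (simp add: space_eq)
        have "(\<lambda>i. \<bar>g i x - f x\<bar> powr p) \<longlonglongrightarrow> 0 powr p"
          using g_lim[OF x] \<open>p > 0\<close> by (intro tendsto_powr2[OF _ tendsto_const]) auto
        then show "(\<lambda>i. ennreal (\<bar>g i x - f x\<bar> powr p)) \<longlonglongrightarrow> 0"
          using tendsto_ennrealI by fastforce
      qed
    qed measurable
    then have "eventually (\<lambda>i. (\<integral>\<^sup>+x. ennreal (\<bar>g i x - f x\<bar> powr p) \<partial>\<mm>) < ennreal \<epsilon>) sequentially"
      using \<open>\<epsilon> > 0\<close> by (intro order_tendstoD(2)) auto
    then obtain i where i: "(\<integral>\<^sup>+x. ennreal (\<bar>g i x - f x\<bar> powr p) \<partial>\<mm>) < ennreal \<epsilon>"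
      unfolding eventually_sequentially by blast
    interpret Di: Metric_space M "di i" by (rule di_metric)
    have "Di.boundedly_supported (g i)"
    proof -
      have "{x \<in> M. g i x \<noteq> 0} \<subseteq> {x \<in> M. f x \<noteq> 0}" using g_0 by auto
      then have "Di.mtopology closure_of {x \<in> M. g i x \<noteq> 0} \<subseteq> S"
        unfolding S_def di_topology by (rule closure_of_mono)
      with mbounded_di[OF S_bounded] show ?thesis
        unfolding Di.boundedly_supported_def by (rule Di.mbounded_subset)
    qed
    moreover have "(\<integral>\<^sup>+x. ennreal (Di.lip_a (g i) x powr p) \<partial>\<mm>)
        \<le> (\<integral>\<^sup>+x. ennreal (lip_a f x powr p) \<partial>\<mm>) + ennreal \<epsilon>"
    proof -
      have "(\<integral>\<^sup>+x. ennreal (Di.lip_a (g i) x powr p) \<partial>\<mm>)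
          \<le> (\<integral>\<^sup>+x. ennreal (\<rho> i x powr p) * indicator S x \<partial>\<mm>)"
      proof (rule nn_integral_mono)
        fix x assume "x \<in> space \<mm>"
        then have x: "x \<in> M" by (simp add: space_eq)
        show "ennreal (Di.lip_a (g i) x powr p) \<le> ennreal (\<rho> i x powr p) * indicator S x"
        proof (cases "x \<in> S")
          case True
          have "Di.lip_a (g i) x \<le> \<rho> i x"
            unfolding g_def
            by (rule Di.lip_a_chain_median_le[where F = F])
               (use \<rho>_nonneg F(2) x g_LIP[of i] \<rho>(1)[of i] di_topology[of i] in \<open>auto simp: g_def\<close>)
          then show ?thesis
            using True \<open>p > 0\<close> Di.lip_a_nonneg[OF g_LIP]
            by (auto intro!: ennreal_leI powr_mono2)
        next
          case False
          have "openin Di.mtopology (M - S)"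
            using S_closed unfolding di_topology by (auto simp: closedin_def)
          then obtain r where r: "r > 0" "Di.mball x r \<subseteq> M - S"
            unfolding Di.openin_mtopology using x False by blast
          have g_ball: "g i y = 0" if "y \<in> Di.mball x r" for y
            using that r(2) off_S g_0 by blast
          have "Di.Lip (g i) (Di.mball x r) \<le> 0"
            by (rule Di.Lip_le) (use g_ball in auto)
          then have "Di.lip_a (g i) x = 0"
            using Di.lip_a_le_Lip_mball[OF g_LIP r(1), of x] Di.lip_a_nonneg[OF g_LIP, of x] by linarith
          then show ?thesis by simp
        qed
      qed
      also have "\<dots> \<le> (\<integral>\<^sup>+x. ennreal (\<theta> x powr p) * indicator S x \<partial>\<mm>) + ennreal (\<epsilon> / 2)"
        by (rule \<rho>(4))
      also have "\<dots> \<le> (\<integral>\<^sup>+x. ennreal (lip_a f x powr p) * indicator S x \<partial>\<mm>)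
          + ennreal (\<epsilon> / 2) + ennreal (\<epsilon> / 2)"
        by (rule add_right_mono[OF \<theta>(5)])
      also have "\<dots> = (\<integral>\<^sup>+x. ennreal (lip_a f x powr p) * indicator S x \<partial>\<mm>) + ennreal \<epsilon>"
        using \<open>\<epsilon> > 0\<close> by (simp add: add.assoc ennreal_plus[symmetric] del: ennreal_plus)
      also have "\<dots> \<le> (\<integral>\<^sup>+x. ennreal (lip_a f x powr p) \<partial>\<mm>) + ennreal \<epsilon>"
        by (intro add_right_mono nn_integral_mono) (auto simp: indicator_def)
      finally show ?thesis .
    qed
    ultimately show ?thesis
      using g_LIP i by (intro exI[of _ i] exI[of _ "g i"]) auto
  qed
qed

end
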